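(* Let $r\ge0$, let $\sigma:[0,1]\to[-r,1]$ and $\omega:[-r,0]\to[0,\infty)$ be continuous, let $f:[0,1]\times[0,\infty)\times[0,\infty)\to[0,\infty)$, and let $\rho>0$. Assume: (H1) for all $u,v\in\mathcal C([0,1],[0,\infty))$ the function $t\in[0,1]\mapsto f(t,u(t),v(t))$ is measurable; (H2) there is $M_\rho\in L^1([0,1])$ with $f(t,u,v)\le M_\rho(t)$ for a.a. $t\in[0,1]$ and all $0\le u,v\le\rho+\|\omega\|_{[-r,0]}$; (H3) there is $\delta_\rho\in L^1([1/4,3/4])$ with $f(t,u,v)\ge\delta_\rho(t)$ for a.a. $t\in[1/4,3/4]$ and all $0\le u,v\le\rho+\|\omega\|_{[-r,0]}$, and $\bar\delta:=\sup_{t\in[1/4,3/4]}\int_{1/4}^{3/4}k(t,s)\delta_\rho(s)\,ds>0$; (H4) there are countably many curves $\gamma_n:I_n=[a_n,b_n]\to[0,\infty)$, $n\in\mathbb N$, such that for a.a. $t\in[0,1]$ the function $f(t,\cdot,\cdot)$ is continuous on $\big([0,\infty)\setminus\bigcup_{n:\,t\in I_n}\{\gamma_n(t)\}\big)\times[0,\infty)$, and there is $\bar\lambda>\rho/\bar\delta$ such that each $\gamma_n$ is a $\lambda$-admissible discontinuity curve for every $\lambda\in(0,\bar\lambda]$. Then there exist $\lambda_\rho\in(0,\bar\lambda)$ and $u_\rho\in\partial K_{y,\rho}$ satisfying $u_\rho(t)=y(t)+\lambda_\rho\int_0^1k(t,s)f(s,u_\rho(s),u_\rho(\sigma(s)))\,ds$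 for all $t\in[-r,1]$.
   Context: Notation: $\|u\|_{[a,b]}=\sup_{t\in[a,b]}|u(t)|$. Let $G(t,s)=t(1-s)$ if $0\le t\le s\le1$ and $G(t,s)=(1-t)s$ if $0\le s<t\le1$; define $k:[-r,1]\times[0,1]\to\mathbb R$ by $k(t,s)=G(t,s)$ if $t\ge0$ and $k(t,s)=0$ if $t<0$. Define $y\in\mathcal C([-r,1])$ by $y(t)=\omega(t)$ for $t\le0$ and $y(t)=(1-t)\omega(0)$ for $t>0$. Let $X=\mathcal C([-r,1])$ with the sup norm and $K=\{u\in\mathcal C([-r,1],[0,\infty)): u(t)=0\ \forall t\in[-r,0],\ \min_{t\in[1/4,3/4]}u(t)\ge\tfrac14\|u\|_{[0,1]}\}$, $K_y=y+K$, $K_{y,\rho}=\{y+u:u\in K,\ \|u\|_{[0,1]}<\rho\}$, and $\partial K_{y,\rho}$ its boundary relative to $K_y$, i.e. $\{y+u:u\in K,\ \|u\|_{[0,1]}=\rho\}$. Functions $u\in\mathcal C([-r,1])$ satisfying $u=y+\lambda\int_0^1k(\cdot,s)f(s,u(s),u(\sigma(s)))\,ds$ on $[-r,1]$ are the solutions of the problem $u''(t)+\lambda f(t,u(t),u(\sigma(t)))=0$ on $[0,1]$, $u=\omega$ on $[-r,0]$, $u(1)=0$. A $\lambda$-admissible discontinuity curve (for $u''+\lambda f(t,u,u(\sigma))=0$) is a function $\gamma\in W^{2,1}([a,b])$, $[a,b]\subset[0,1]$, $\gamma\ge0$, for which there exist $\varepsilon>0$ and $\psi\in L^1(a,b)$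 with $\psi>0$ a.e. such that either $-\gamma''(t)+\psi(t)<\lambda f(t,y,z)$ for a.a. $t\in[a,b]$, all $y\in[\gamma(t)-\varepsilon,\gamma(t)+\varepsilon]$ and all $z\ge0$; or $-\gamma''(t)-\psi(t)>\lambda f(t,y,z)$ for a.a. $t\in[a,b]$, all such $y$ and all $z\ge0$. *)

theory Defs
  imports "HOL-Analysis.Analysis"
begin

definition supnorm :: "real \<Rightarrow> real \<Rightarrow> (real \<Rightarrow> real) \<Rightarrow> real" where
  "supnorm a b u = (SUP t\<in>{a..b}. \<bar>u t\<bar>)"

definition G :: "real \<Rightarrow> real \<Rightarrow> real" where
  "G t s = (if t \<le> s then t * (1 - s) else (1 - t) * s)"

definition kker :: "real \<Rightarrow> real \<Rightarrow> real" where
  "kker t s = (if 0 \<le> t then G t s else 0)"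

definition yfun :: "(real \<Rightarrow> real) \<Rightarrow> real \<Rightarrow> real" where
  "yfun \<omega> t = (if t \<le> 0 then \<omega> t else (1 - t) * \<omega> 0)"

definition coneK :: "real \<Rightarrow> (real \<Rightarrow> real) set" where
  "coneK r = {u. continuous_on {-r..1} u \<and> (\<forall>t\<in>{-r..1}. 0 \<le> u t)
      \<and> (\<forall>t\<in>{-r..0}. u t = 0)
      \<and> (\<forall>t\<in>{1/4..3/4}. u t \<ge> supnorm 0 1 u / 4)}"

text \<open>Boundary of K_{y,rho} relative to K_y: functions y + u with u in K and norm rho.\<close>
definition bdKy :: "real \<Rightarrow> (real \<Rightarrow> real) \<Rightarrow> real \<Rightarrow> (real \<Rightarrow> real) set" where
  "bdKy r y \<rho> = {w. \<exists>u\<in>coneK r. supnorm 0 1 u = \<rho> \<and> (\<forall>t\<in>{-r..1}. w t = y t + u t)}"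

text \<open>W^{2,1}([a,b]) with weak second derivative g: gamma has an absolutely
  continuous derivative gamma1 whose derivative is the L^1 function g.\<close>
definition W21 :: "real \<Rightarrow> real \<Rightarrow> (real \<Rightarrow> real) \<Rightarrow> (real \<Rightarrow> real) \<Rightarrow> bool" where
  "W21 a b \<gamma> g \<longleftrightarrow> set_integrable lebesgue {a..b} g \<and>
     (\<exists>\<gamma>1. \<forall>t\<in>{a..b}.
        \<gamma>1 t = \<gamma>1 a + (LINT s:{a..t}|lebesgue. g s) \<and>
        \<gamma> t = \<gamma> a + (LINT s:{a..t}|lebesgue. \<gamma>1 s))"

text \<open>lambda-admissible discontinuity curve for u'' + lambda f(t,u,u(sigma)) = 0.\<close>
definition admissible ::
  "(real \<Rightarrow> real \<Rightarrow> real \<Rightarrow> real) \<Rightarrow> real \<Rightarrow> real \<Rightarrow> real \<Rightarrow> (real \<Rightarrow> real) \<Rightarrow> bool" where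
  "admissible f lam a b \<gamma> \<longleftrightarrow> 0 \<le> a \<and> a \<le> b \<and> b \<le> 1 \<and>
     (\<forall>t\<in>{a..b}. 0 \<le> \<gamma> t) \<and>
     (\<exists>g. W21 a b \<gamma> g \<and>
       (\<exists>\<epsilon>>0. \<exists>\<psi>. set_integrable lebesgue {a..b} \<psi> \<and>
          (AE t in lebesgue. t \<in> {a..b} \<longrightarrow> \<psi> t > 0) \<and>
          ((AE t in lebesgue. t \<in> {a..b} \<longrightarrow>
              (\<forall>y z. 0 \<le> y \<and> \<gamma> t - \<epsilon> \<le> y \<and> y \<le> \<gamma> t + \<epsilon> \<and> 0 \<le> z \<longrightarrow>
                 - g t + \<psi> t < lam * f t y z))
           \<or> (AE t in lebesgue. t \<in> {a..b} \<longrightarrow>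
              (\<forall>y z. 0 \<le> y \<and> \<gamma> t - \<epsilon> \<le> y \<and> y \<le> \<gamma> t + \<epsilon> \<and> 0 \<le> z \<longrightarrow>
                 - g t - \<psi> t > lam * f t y z)))))"

end

theory Submission
  imports Defs "HOL-Complex_Analysis.Great_Picard"
begin

text \<open>
  The unknown is the primitive \<open>H\<close> of \<open>h(s) = f(s, u(s), u(\<sigma>(s)))\<close>; then \<open>V = green_op H\<close> solves
  \<open>V'' = - h\<close> and \<open>u = y + \<rho> V / \<parallel>V\<parallel>\<close>, so that any solution has the prescribed norm and
  \<open>\<lambda> = \<rho> / \<parallel>V\<parallel>\<close>. Divide \<open>[0,1]\<close> into \<open>n\<close> cells and take the increments of \<open>H\<close> over the cells as
  coordinates. Kuhn's combinatorial lemma, applied to the discontinuous map itself, gives \<open>H\<^sub>n\<close> whose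
  increment over each cell lies, up to \<open>O(1/n)\<close>, between \<open>\<integral>f(s, u\<^sup>-(s), u\<^sup>-(\<sigma>(s))) ds\<close> and
  \<open>\<integral>f(s, u\<^sup>+(s), u\<^sup>+(\<sigma>(s))) ds\<close> for functions \<open>u\<^sup>-\<close>, \<open>u\<^sup>+\<close> (depending on the cell) close to the one
  determined by \<open>H\<^sub>n\<close>. By Arzela-Ascoli \<open>H\<^sub>n\<close> converges uniformly to some \<open>H\<close> along a subsequence, and
  (H3) gives \<open>\<parallel>V\<parallel> \<ge> \<delta>bar\<close>, hence \<open>\<lambda> < lbar\<close>.

  On the set where the limit \<open>u\<close> meets a curve \<open>\<gamma>\<close>, admissibility bounds \<open>- u''\<close> strictly away from
  \<open>- \<gamma>''\<close>; by Lebesgue differentiation almost every such contact point is isolated on the right in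
  the contact set, so the contact set is null. Hence \<open>f(s, \<cdot>, \<cdot>)\<close> is continuous at \<open>(u(s), u(\<sigma>(s)))\<close>
  for almost all \<open>s\<close> and dominated convergence identifies \<open>H\<close>. As (H4) only gives continuity
  relative to the complement of the curves, the approximations \<open>u\<^sup>-\<close>, \<open>u\<^sup>+\<close> are shifted so that they,
  too, avoid all curves almost everywhere.
\<close>

section \<open>Null contact sets\<close>

lemma negligible_iff_AE: "negligible {t. \<not> P t} \<longleftrightarrow> (AE t in lebesgue. P t)"
proof
  assume "negligible {t. \<not> P t}"
  then show "AE t in lebesgue. P t"
    unfolding negligible_iff_null_sets by (rule AE_I') auto
next
  assume "AE t in lebesgue. P t"
  then obtain N where "N \<in> null_sets lebesgue" "{t. \<not> P t} \<subseteq> N"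
    by (auto simp: eventually_ae_filter)
  then show "negligible {t. \<not> P t}"
    by (meson negligible_iff_null_sets negligible_subset)
qed

text \<open>Give each such point x a rational \<open>q x\<close> beyond x with no point of
  \<open>A\<close> strictly in between. Any later point lies at or beyond \<open>q x\<close> and its
  own rational is larger still, so \<open>q\<close> injects the set into the rationals.\<close>

lemma countable_right_isolated:
  fixes A :: "real set"
  shows "countable {x\<in>A. \<exists>q>x. A \<inter> {x<..<q} = {}}"
proof -
  let ?B = "{x\<in>A. \<exists>q>x. A \<inter> {x<..<q} = {}}"
  have "\<exists>q\<in>\<rat>. x < q \<and> A \<inter> {x<..<q} = {}" if "x \<in> ?B" for x
  proof -
    from that obtain q where q: "q > x" "A \<inter> {x<..<q} = {}" by auto
    obtain p where "p \<in> \<rat>" "x < p" "p < q" using Rats_dense_in_real[OF q(1)] by blast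
    moreover have "A \<inter> {x<..<p} \<subseteq> A \<inter> {x<..<q}" using \<open>p < q\<close> by auto
    then have "A \<inter> {x<..<p} = {}" using q(2) by blast
    ultimately show ?thesis by blast
  qed
  then obtain q where q: "\<And>x. x \<in> ?B \<Longrightarrow> q x \<in> \<rat> \<and> x < q x \<and> A \<inter> {x<..<q x} = {}"
    by (metis (no_types, lifting))
  have "inj_on q ?B"
  proof (rule linorder_inj_onI')
    fix x z assume xz: "x \<in> ?B" "z \<in> ?B" "x < z"
    then have "z \<notin> {x<..<q x}" using q[of x] by blast
    then show "q x \<noteq> q z" using q[of z] xz by auto
  qed
  moreover have "countable (q ` ?B)"
    by (rule countable_subset[OF _ countable_rat]) (use q in auto)
  ultimately show ?thesis
    using countable_image_inj_on by blast
qed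

text \<open>Heuristically \<open>D'' \<le> - w\<close>, with \<open>w > 0\<close> almost everywhere
  on the zero set of \<open>D\<close>. At a zero accumulated by zeros from the right,
  \<open>d\<close> vanishes there and at points arbitrarily close on the right, while
  \<open>dec\<close> and Lebesgue differentiation of \<open>w\<close> make \<open>d\<close> negative
  at such points. So almost every zero is isolated on the right, and those are countably
  many.\<close>

lemma negligible_contact_set:
  fixes D d w :: "real \<Rightarrow> real"
  assumes D: "\<And>t. t \<in> {a..b} \<Longrightarrow> (D has_real_derivative d t) (at t within {a..b})"
    and d: "continuous_on {a..b} d"
    and w: "w integrable_on {a..b}"
    and dec: "\<And>x y. a \<le> x \<Longrightarrow> x \<le> y \<Longrightarrow> y \<le> b \<Longrightarrow> d y - d x \<le> - integral {x..y} w"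
    and pos: "AE t in lebesgue. t \<in> {a..b} \<longrightarrow> D t = 0 \<longrightarrow> w t > 0"
  shows "negligible {t\<in>{a..b}. D t = 0}"
proof -
  let ?A = "{t\<in>{a..b}. D t = 0}"
  let ?B = "{x\<in>?A. \<exists>q>x. ?A \<inter> {x<..<q} = {}}"
  \<comment> \<open>The zero extension is integrable over every box, as Lebesgue differentiation
    requires; \<open>N\<close> collects the points where the averages fail to converge.\<close>
  define w0 where "w0 t = (if t \<in> {a..b} then w t else 0)" for t
  have w0UNIV: "w0 integrable_on UNIV"
    unfolding w0_def using w by (simp only: integrable_restrict_UNIV)
  have w0: "w0 integrable_on cbox x y" for x y
    by (rule integrable_on_subcbox[OF w0UNIV]) auto
  obtain N where N: "negligible N"
    and N_lim: "\<And>x e. \<lbrakk>x \<notin> N; 0 < e\<rbrakk> \<Longrightarrow>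
        \<exists>\<delta>>0. \<forall>h. 0 < h \<and> h < \<delta> \<longrightarrow>
          norm (integral (cbox x (x + h *\<^sub>R One)) w0 /\<^sub>R h ^ DIM(real) - w0 x) < e"
    using integrable_ccontinuous_explicit[OF w0] by blast
  have "negligible {t. \<not> (t \<in> {a..b} \<longrightarrow> D t = 0 \<longrightarrow> w t > 0)}" (is "negligible ?N'")
    using pos by (simp only: negligible_iff_AE)
  have "?A \<subseteq> N \<union> ?N' \<union> ?B \<union> {b}"
  proof (rule subsetI, rule ccontr)
    fix t assume t: "t \<in> ?A" and "t \<notin> N \<union> ?N' \<union> ?B \<union> {b}"
    then have tN: "t \<notin> N" and tN': "t \<notin> ?N'" and tB: "t \<notin> ?B" and tb: "t \<noteq> b"
      by blast+
    from t tb have tab: "a \<le> t" "t < b" and Dt: "D t = 0" by auto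
    from tN' t have wt: "w t > 0" by blast
    \<comment> \<open>Rolle's theorem between t and another zero of \<open>D\<close> below q, which
      exists because t is not isolated on the right.\<close>
    have crit: "\<exists>\<xi>. t < \<xi> \<and> \<xi> < q \<and> d \<xi> = 0" if q: "q > t" for q
    proof -
      from tB t q have "?A \<inter> {t<..<q} \<noteq> {}" by blast
      then obtain z where "z \<in> ?A \<inter> {t<..<q}" by blast
      then have z: "z \<in> ?A" "t < z" "z < q" by auto
      obtain \<xi> where "t < \<xi>" "\<xi> < z" "D z - D t = (\<lambda>h. d \<xi> * h) (z - t)"
      proof (rule mvt[OF \<open>t < z\<close>])
        have sub: "{t..z} \<subseteq> {a..b}" using z tab by auto
        show "continuous_on {t..z} D"
          by (rule continuous_on_subset[OF _ sub])
             (auto simp: continuous_on_eq_continuous_within intro: DERIV_continuous D)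
        fix x assume x: "t < x" "x < z"
        then have "(D has_real_derivative d x) (at x within {a..b})" using D z tab by auto
        then have "(D has_real_derivative d x) (at x within {t<..<z})"
          by (rule DERIV_subset) (use sub in auto)
        then show "(D has_derivative (\<lambda>h. d x * h)) (at x)"
          using x by (simp add: has_field_derivative_def at_within_open[of x "{t<..<z}"])
      qed
      then have "d \<xi> = 0" using z Dt by auto
      then show ?thesis using \<open>t < \<xi>\<close> \<open>\<xi> < z\<close> z(3) by (intro exI[of _ \<xi>]) simp
    qed
    have dt: "d t = 0"
    proof (rule ccontr)
      assume "d t \<noteq> 0"
      then obtain \<delta> where \<delta>: "\<delta> > 0" "\<And>x. x \<in> {a..b} \<Longrightarrow> dist x t < \<delta> \<Longrightarrow> dist (d x) (d t) < \<bar>d t\<bar>"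
        using d[unfolded continuous_on_iff, rule_format, of t "\<bar>d t\<bar>"] tab by auto
      obtain \<xi> where "t < \<xi>" "\<xi> < min b (t + \<delta>)" "d \<xi> = 0"
        using crit[of "min b (t+\<delta>)"] \<delta>(1) tab by auto
      then show False using \<delta>(2)[of \<xi>] tab by (auto simp: dist_real_def)
    qed
    have w0t: "w0 t = w t" using tab by (simp add: w0_def)
    \<comment> \<open>The tolerance \<open>w t\<close> is just small enough to keep the averages of
      \<open>w0\<close> over short intervals to the right of t positive.\<close>
    obtain \<delta> where \<delta>: "\<delta> > 0" "\<And>h. 0 < h \<and> h < \<delta> \<Longrightarrow>
          norm (integral (cbox t (t + h *\<^sub>R One)) w0 /\<^sub>R h ^ DIM(real) - w0 t) < w t"
      using N_lim[OF tN wt] by blast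
    obtain \<xi> where \<xi>: "t < \<xi>" "\<xi> < min b (t + \<delta>)" "d \<xi> = 0"
      using crit[of "min b (t+\<delta>)"] \<delta>(1) tab by auto
    have "\<bar>integral {t..\<xi>} w0 / (\<xi> - t) - w t\<bar> < w t"
      using \<delta>(2)[of "\<xi> - t"] \<xi> w0t by (simp add: divide_inverse mult.commute)
    then have "integral {t..\<xi>} w0 / (\<xi> - t) > 0" by linarith
    then have "integral {t..\<xi>} w0 > 0" using \<xi> by (simp add: zero_less_divide_iff)
    moreover have "integral {t..\<xi>} w0 = integral {t..\<xi>} w"
      by (rule integral_cong) (use \<xi> tab in \<open>auto simp: w0_def\<close>)
    ultimately show False using dec[of t \<xi>] \<xi> tab dt by auto
  qed
  moreover have "negligible ?B"
    unfolding negligible_iff_null_sets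
    by (rule null_sets_completionI[OF countable_imp_null_set_lborel[OF countable_right_isolated]])
  ultimately show ?thesis
    using N \<open>negligible ?N'\<close> by (intro negligible_subset[of "N \<union> ?N' \<union> ?B \<union> {b}" ?A] negligible_Un negligible_sing)
qed

section \<open>The Green operator acting on primitives\<close>

text \<open>If \<open>H\<close> is a primitive of \<open>h\<close>, then \<open>green_op H\<close> solves \<open>v'' = - h\<close>, \<open>v(0) = v(1) = 0\<close>; working with \<open>H\<close>
  instead of \<open>h\<close> makes the operator continuous for uniform convergence.\<close>

definition green_op :: "(real \<Rightarrow> real) \<Rightarrow> real \<Rightarrow> real" where
  "green_op H t = t * integral {0..1} H - integral {0..t} H"

lemma absolutely_integrable_continuous_product:
  fixes c h :: "real \<Rightarrow> real"
  assumes c: "continuous_on {a..b} c" and h: "h absolutely_integrable_on {a..b}"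
  shows "(\<lambda>s. c s * h s) absolutely_integrable_on {a..b}"
proof (rule absolutely_integrable_bounded_measurable_product_real[OF _ _ _ h])
  show "c \<in> borel_measurable (lebesgue_on {a..b})"
    by (rule continuous_imp_measurable_on_sets_lebesgue[OF c]) simp
  show "bounded (c ` {a..b})"
    by (rule compact_imp_bounded[OF compact_continuous_image[OF c]]) simp
qed simp

lemma integral_increment:
  fixes f :: "real \<Rightarrow> real"
  assumes "f integrable_on {0..1}" "0 \<le> a" "a \<le> b" "b \<le> 1"
  shows "integral {0..b} f - integral {0..a} f = integral {a..b} f"
proof -
  have "f integrable_on {0..b}" by (rule integrable_on_subinterval[OF assms(1)]) (use assms in auto)
  then show ?thesis
    using Henstock_Kurzweil_Integration.integral_combine[of 0 a b f] assms by auto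
qed

text \<open>This exchanges the order of integration over a triangle. Since \<open>h\<close> is only
  integrable, \<open>H\<close> need not be differentiable everywhere, but
  \<open>W t = t * H t - S t\<close> is, with the continuous derivative \<open>H\<close>, so the
  fundamental theorem applies to \<open>W\<close>.\<close>

lemma integral_triangle:
  fixes h :: "real \<Rightarrow> real"
  assumes h: "h absolutely_integrable_on {0..1}" and t: "t \<in> {0..1}"
  shows "integral {0..t} (\<lambda>s. (t - s) * h s) = integral {0..t} (\<lambda>s. integral {0..s} h)"
proof -
  define H where "H t = integral {0..t} h" for t
  define S where "S t = integral {0..t} (\<lambda>s. s * h s)" for t
  define m where "m t = integral {0..t} (\<lambda>s. \<bar>h s\<bar>)" for t
  have sh: "(\<lambda>s. s * h s) absolutely_integrable_on {0..1}"
    using continuous_on_id h by (rule absolutely_integrable_continuous_product)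
  have habs: "(\<lambda>s. \<bar>h s\<bar>) absolutely_integrable_on {0..1}"
    using absolutely_integrable_norm[OF h] by (simp add: o_def)
  note ints = h[THEN set_lebesgue_integral_eq_integral(1)] sh[THEN set_lebesgue_integral_eq_integral(1)]
    habs[THEN set_lebesgue_integral_eq_integral(1)]
  have isub: "g integrable_on {x..y}" if "g integrable_on {0..1}" "0 \<le> x" "y \<le> 1" for g :: "real\<Rightarrow>real" and x y
    by (rule integrable_on_subinterval[OF that(1)]) (use that in auto)
  \<comment> \<open>For \<open>c = y\<close> the left side is the remainder of \<open>W\<close>
    after the linear term \<open>(y - x) * H x\<close>. The factor \<open>m y - m x\<close> tends to
    0, so the remainder is of lower order than \<open>y - x\<close>; the case \<open>y < x\<close>
    uses the same bound with the end points exchanged.\<close>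
  have key: "\<bar>c * (H y - H x) - (S y - S x)\<bar> \<le> (y - x) * (m y - m x)"
    if xy: "0 \<le> x" "x \<le> y" "y \<le> 1" and c: "x \<le> c" "c \<le> y" for x y c
  proof -
    have i1: "(\<lambda>s. c * h s) integrable_on {x..y}" and i2: "(\<lambda>s. s * h s) integrable_on {x..y}"
      and i3: "(\<lambda>s. \<bar>h s\<bar>) integrable_on {x..y}"
      using isub ints xy by (auto intro!: integrable_on_mult_right)
    have "c * (H y - H x) - (S y - S x) = integral {x..y} (\<lambda>s. c * h s) - integral {x..y} (\<lambda>s. s * h s)"
      unfolding H_def S_def using integral_increment[OF ints(1) xy] integral_increment[OF ints(2) xy] by simp
    also have "\<dots> = integral {x..y} (\<lambda>s. c * h s - s * h s)"
      using i1 i2 by (rule Henstock_Kurzweil_Integration.integral_diff[symmetric])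
    also have "norm \<dots> \<le> integral {x..y} (\<lambda>s. (y - x) * \<bar>h s\<bar>)"
    proof (rule integral_norm_bound_integral)
      fix s assume s: "s \<in> {x..y}"
      have "norm (c * h s - s * h s) = \<bar>c - s\<bar> * \<bar>h s\<bar>" by (simp add: abs_mult[symmetric] algebra_simps)
      also have "\<dots> \<le> (y - x) * \<bar>h s\<bar>" using s c by (intro mult_right_mono) auto
      finally show "norm (c * h s - s * h s) \<le> (y - x) * \<bar>h s\<bar>" .
    qed (use i1 i2 i3 in \<open>auto intro!: Henstock_Kurzweil_Integration.integrable_diff integrable_on_mult_right\<close>)
    also have "\<dots> = (y - x) * (m y - m x)"
      unfolding m_def using integral_increment[OF ints(3) xy] by simp
    finally show ?thesis by simp
  qed
  define W where "W t = t * H t - S t" for t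
  have contH: "continuous_on {0..1} H" and contm: "continuous_on {0..1} m"
    unfolding H_def m_def using ints by (auto intro!: indefinite_integral_continuous_1)
  have W': "(W has_real_derivative H x) (at x within {0..t})" if x: "x \<in> {0..t}" for x
  proof -
    have "((\<lambda>y. (W y - W x) / (y - x) - H x) \<longlongrightarrow> 0) (at x within {0..t})"
    proof (rule Lim_null_comparison)
      show "\<forall>\<^sub>F y in at x within {0..t}. norm ((W y - W x) / (y - x) - H x) \<le> \<bar>m y - m x\<bar>"
        unfolding eventually_at_filter
      proof (intro always_eventually allI impI)
        fix y assume y: "y \<noteq> x" "y \<in> {0..t}"
        have e: "W y - W x - (y - x) * H x = y * (H y - H x) - (S y - S x)"
          by (simp add: W_def algebra_simps)
        have "\<bar>y * (H y - H x) - (S y - S x)\<bar> \<le> \<bar>y - x\<bar> * \<bar>m y - m x\<bar>"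
        proof (cases "x \<le> y")
          case True
          then have "\<bar>y * (H y - H x) - (S y - S x)\<bar> \<le> (y - x) * (m y - m x)"
            using key[of x y y] x y t by simp
          also have "\<dots> \<le> \<bar>(y - x) * (m y - m x)\<bar>" by (rule abs_ge_self)
          finally show ?thesis by (simp add: abs_mult)
        next
          case False
          have "\<bar>y * (H y - H x) - (S y - S x)\<bar> = \<bar>y * (H x - H y) - (S x - S y)\<bar>"
            by (simp add: right_diff_distrib abs_minus_commute)
          also have "\<dots> \<le> (x - y) * (m x - m y)"
            using key[of y x y] x y t False by simp
          also have "\<dots> \<le> \<bar>(x - y) * (m x - m y)\<bar>" by (rule abs_ge_self)
          finally show ?thesis by (simp add: abs_mult abs_minus_commute)
        qed
        then have "\<bar>W y - W x - (y - x) * H x\<bar> / \<bar>y - x\<bar> \<le> \<bar>m y - m x\<bar>"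
          using y e by (simp add: divide_le_eq mult.commute)
        moreover have "(W y - W x) / (y - x) - H x = (W y - W x - (y - x) * H x) / (y - x)"
          using y by (simp add: field_simps)
        ultimately show "norm ((W y - W x) / (y - x) - H x) \<le> \<bar>m y - m x\<bar>" by simp
      qed
      have "(m \<longlongrightarrow> m x) (at x within {0..t})"
        using continuous_on_subset[OF contm, of "{0..t}"] x t by (auto simp: continuous_on_def)
      then have "((\<lambda>y. m y - m x) \<longlongrightarrow> m x - m x) (at x within {0..t})" by (intro tendsto_intros)
      then show "((\<lambda>y. \<bar>m y - m x\<bar>) \<longlongrightarrow> 0) (at x within {0..t})"
        by (simp add: tendsto_rabs_zero)
    qed
    then show ?thesis unfolding has_field_derivative_iff by (simp add: LIM_zero_iff)
  qed
  have "(H has_integral (W t - W 0)) {0..t}"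
    by (rule fundamental_theorem_of_calculus)
       (use t W' in \<open>auto simp: has_real_derivative_iff_has_vector_derivative[symmetric]\<close>)
  then have "integral {0..t} H = W t" by (simp add: integral_unique W_def S_def)
  moreover have "integral {0..t} (\<lambda>s. (t - s) * h s) = W t"
  proof -
    have "integral {0..t} (\<lambda>s. t * h s - s * h s) = integral {0..t} (\<lambda>s. t * h s) - integral {0..t} (\<lambda>s. s * h s)"
      by (rule Henstock_Kurzweil_Integration.integral_diff)
         (use isub[OF ints(1), of 0 t] isub[OF ints(2), of 0 t] t in \<open>auto intro!: integrable_on_mult_right\<close>)
    then show ?thesis by (simp add: W_def H_def S_def algebra_simps)
  qed
  ultimately show ?thesis by (simp add: H_def[abs_def])
qed

section \<open>The Green function: pointwise estimates and its relation to
  \<open>green_op\<close>\<close>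

lemma G_eq_min: "G t s = min t s - t * s"
  by (simp add: G_def min_def algebra_simps)

lemma continuous_on_G: "continuous_on A (G t)"
  unfolding G_eq_min[abs_def] by (intro continuous_intros)

lemma G_nonneg: "t \<in> {0..1} \<Longrightarrow> s \<in> {0..1} \<Longrightarrow> 0 \<le> G t s"
  by (auto simp: G_def)

text \<open>The diagonal value \<open>s * (1 - s)\<close> dominates \<open>G t' s\<close> for every
  t', and for t in the middle half a quarter of it is still below \<open>G t s\<close>. This is the
  source of the constant 1/4 in the cone.\<close>

lemma G_ge_quarter:
  assumes t: "t \<in> {1/4..3/4}" and t': "t' \<in> {0..1}" and s: "s \<in> {0..1}"
  shows "G t' s / 4 \<le> G t s"
proof -
  have "G t' s \<le> s * (1 - s)"
  proof (cases "t' \<le> s")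
    case True
    then show ?thesis unfolding G_def using s by (simp add: mult_right_mono)
  next
    case False
    have "(1 - t') * s \<le> (1 - s) * s" using False s by (intro mult_right_mono) auto
    then show ?thesis using False by (simp only: G_def if_False mult.commute[of s "1 - s"])
  qed
  moreover have "s * (1 - s) / 4 \<le> G t s"
  proof (cases "t \<le> s")
    case True
    have "s * (1 - s) \<le> (4 * t) * (1 - s)" using s t by (intro mult_right_mono) auto
    then show ?thesis using True by (simp add: G_def)
  next
    case False
    have "(1 - s) * s \<le> (4 * (1 - t)) * s" using s t by (intro mult_right_mono) auto
    then have "(1 - s) * s \<le> 4 * ((1 - t) * s)" by (simp only: mult.assoc)
    then have "s * (1 - s) / 4 \<le> (1 - t) * s" by (simp only: mult.commute[of s "1 - s"])
    then show ?thesis using False by (simp add: G_def)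
  qed
  ultimately show ?thesis by linarith
qed

text \<open>Up to the factor \<open>h\<close>, the kernel is t(1 - s) minus the positive part of t -
  s. The two terms are triangle integrals with upper limits 1 and t, which
  \<open>integral_triangle\<close> turns into integrals of the primitive.\<close>

lemma green_op_eq_integral_kernel:
  fixes h :: "real \<Rightarrow> real"
  assumes h: "h absolutely_integrable_on {0..1}" and t: "t \<in> {0..1}"
    and H: "\<And>s. s \<in> {0..1} \<Longrightarrow> H s = integral {0..s} h"
  shows "(\<lambda>s. G t s * h s) absolutely_integrable_on {0..1}"
    and "green_op H t = integral {0..1} (\<lambda>s. G t s * h s)"
proof -
  have G: "G t s = t * (1 - s) - (if s \<in> {0..t} then t - s else 0)" if "s \<in> {0..1}" for s
    using that by (auto simp: G_def algebra_simps)
  note prod = absolutely_integrable_continuous_product[OF _ h]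
  show "(\<lambda>s. G t s * h s) absolutely_integrable_on {0..1}" by (rule prod[OF continuous_on_G])
  have i1: "(\<lambda>s. (1 - s) * h s) integrable_on {0..1}" and i2: "(\<lambda>s. (t - s) * h s) integrable_on {0..1}"
    using set_lebesgue_integral_eq_integral(1)[OF prod, of "\<lambda>s. 1 - s"]
      set_lebesgue_integral_eq_integral(1)[OF prod, of "\<lambda>s. t - s"]
    by (simp_all add: continuous_on_diff)
  have i2': "(\<lambda>s. (t - s) * h s) integrable_on {0..t}"
    by (rule integrable_on_subinterval[OF i2]) (use t in auto)
  have i3: "(\<lambda>s. if s \<in> {0..t} then (t - s) * h s else 0) integrable_on {0..1}"
    and e3: "integral {0..1} (\<lambda>s. if s \<in> {0..t} then (t - s) * h s else 0) = integral {0..t} (\<lambda>s. (t - s) * h s)"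
    using i2' t unfolding integral_restrict_Int integrable_restrict_Int by (simp_all add: Int_absorb2)
  have "integral {0..1} (\<lambda>s. G t s * h s)
      = integral {0..1} (\<lambda>s. t * ((1 - s) * h s) - (if s \<in> {0..t} then (t - s) * h s else 0))"
    by (rule integral_cong) (simp add: G left_diff_distrib)
  also have "\<dots> = t * integral {0..1} (\<lambda>s. (1 - s) * h s) - integral {0..t} (\<lambda>s. (t - s) * h s)"
    using i1 i3 e3
    by (subst Henstock_Kurzweil_Integration.integral_diff) (auto intro!: integrable_on_mult_right)
  also have "\<dots> = t * integral {0..1} H - integral {0..t} H"
  proof -
    have "integral {0..1} (\<lambda>s. (1 - s) * h s) = integral {0..1} H"
      using integral_triangle[OF h, of 1] integral_cong[of "{0..1}" H "\<lambda>s. integral {0..s} h"] H by simp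
    moreover have "integral {0..t} (\<lambda>s. (t - s) * h s) = integral {0..t} H"
      using integral_triangle[OF h t] integral_cong[of "{0..t}" H "\<lambda>s. integral {0..s} h"] H t by auto
    ultimately show ?thesis by simp
  qed
  finally show "green_op H t = integral {0..1} (\<lambda>s. G t s * h s)" by (simp add: green_op_def)
qed

text \<open>The mean of an increasing \<open>E\<close> over [0,t] is at most \<open>E t\<close>,
  which is at most its mean over [t,1]. Applied to a difference of primitives, this compares Green
  potentials without reference to densities.\<close>

lemma green_op_nonneg:
  assumes mono: "mono_on {0..1} E" and cont: "continuous_on {0..1} E" and t: "t \<in> {0..1}"
  shows "0 \<le> green_op E t"
proof -
  have int: "E integrable_on {0..1}" using cont by (rule integrable_continuous_interval)
  have int1: "E integrable_on {0..t}" and int2: "E integrable_on {t..1}"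
    using t by (auto intro: integrable_on_subinterval[OF int])
  have "integral {0..t} E \<le> integral {0..t} (\<lambda>_. E t)"
    using int1 t mono by (intro integral_le) (auto simp: mono_on_def)
  moreover have "integral {t..1} (\<lambda>_. E t) \<le> integral {t..1} E"
    using int2 t mono by (intro integral_le) (auto simp: mono_on_def)
  ultimately have le: "integral {0..t} E \<le> t * E t" "(1 - t) * E t \<le> integral {t..1} E"
    using t by auto
  have "integral {0..1} E = integral {0..t} E + integral {t..1} E"
    using Henstock_Kurzweil_Integration.integral_combine[of 0 t 1 E] int t by auto
  then have "green_op E t = t * integral {t..1} E - (1 - t) * integral {0..t} E"
    by (simp add: green_op_def algebra_simps)
  also have "\<dots> \<ge> t * ((1 - t) * E t) - (1 - t) * (t * E t)"
    using le t by (intro diff_mono mult_left_mono) auto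
  finally show ?thesis by simp
qed

lemma green_op_diff_le:
  assumes H: "continuous_on {0..1} H" and H': "continuous_on {0..1} H'"
    and e: "\<And>s. s \<in> {0..1} \<Longrightarrow> \<bar>H s - H' s\<bar> \<le> e" and t: "t \<in> {0..1}"
  shows "\<bar>green_op H t - green_op H' t\<bar> \<le> 2 * e"
proof -
  have e0: "0 \<le> e" using e[of 0] by auto
  have *: "\<bar>integral {0..x} H - integral {0..x} H'\<bar> \<le> e" if x: "x \<in> {0..1}" for x
  proof -
    have ci: "H integrable_on {0..x}" "H' integrable_on {0..x}"
      using H H' x by (auto intro!: integrable_continuous_interval intro: continuous_on_subset)
    have "norm (integral {0..x} (\<lambda>s. H s - H' s)) \<le> integral {0..x} (\<lambda>_. e)"
      using ci e x
      by (intro integral_norm_bound_integral) (auto intro!: Henstock_Kurzweil_Integration.integrable_diff)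
    also have "\<dots> \<le> e" using x e0 by (auto simp: mult_left_le_one_le)
    finally show ?thesis using ci by (simp add: Henstock_Kurzweil_Integration.integral_diff)
  qed
  have "green_op H t - green_op H' t = t * (integral {0..1} H - integral {0..1} H')
      - (integral {0..t} H - integral {0..t} H')"
    by (simp add: green_op_def algebra_simps)
  moreover have "\<bar>t * (integral {0..1} H - integral {0..1} H')\<bar> \<le> 1 * e"
    unfolding abs_mult using t *[of 1] by (intro mult_mono) auto
  ultimately show ?thesis using *[OF t] by linarith
qed

lemma green_op_has_derivative:
  assumes H: "continuous_on {0..1} H" and t: "t \<in> {0..1}"
  shows "(green_op H has_real_derivative integral {0..1} H - H t) (at t within {0..1})"
proof -
  have "((\<lambda>t. t * integral {0..1} H - integral {0..t} H) has_real_derivative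
      1 * integral {0..1} H - H t) (at t within {0..1})"
    by (intro DERIV_diff DERIV_cmult_right DERIV_ident integral_has_real_derivative[OF H t])
  then show ?thesis by (simp add: green_op_def[abs_def])
qed

section \<open>Kuhn's lemma for increments\<close>

text \<open>For \<open>m\<close> a primitive of \<open>M\<close>, these are the primitives of
  densities between 0 and \<open>M\<close>. Stated through increments, the class is closed under
  pointwise limits and inherits equicontinuity from \<open>m\<close>.\<close>

definition increments_below :: "(real \<Rightarrow> real) \<Rightarrow> (real \<Rightarrow> real) set" where
  "increments_below m = {H. H 0 = 0 \<and>
     (\<forall>a b. 0 \<le> a \<longrightarrow> a \<le> b \<longrightarrow> b \<le> 1 \<longrightarrow> 0 \<le> H b - H a \<and> H b - H a \<le> m b - m a)}"

lemma increments_belowD: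
  assumes "H \<in> increments_below m"
  shows "H 0 = 0" "0 \<le> a \<Longrightarrow> a \<le> b \<Longrightarrow> b \<le> 1 \<Longrightarrow> H a \<le> H b"
    "0 \<le> a \<Longrightarrow> a \<le> b \<Longrightarrow> b \<le> 1 \<Longrightarrow> H b - H a \<le> m b - m a"
  using assms unfolding increments_below_def by (simp, force, blast)

lemma increments_below_abs_diff_le:
  assumes "H \<in> increments_below m" "x \<in> {0..1}" "y \<in> {0..1}"
  shows "\<bar>H x - H y\<bar> \<le> \<bar>m x - m y\<bar>"
  using increments_belowD(2,3)[OF assms(1), of x y] increments_belowD(2,3)[OF assms(1), of y x] assms(2,3)
  by (cases "x \<le> y") auto

lemma increments_below_continuous:
  assumes m: "continuous_on {0..1} m" and H: "H \<in> increments_below m"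
  shows "continuous_on {0..1} H"
  unfolding continuous_on_iff
proof (intro ballI allI impI)
  fix x e :: real assume x: "x \<in> {0..1}" and e: "0 < e"
  obtain d where d: "d > 0" "\<And>x'. x' \<in> {0..1} \<Longrightarrow> dist x' x < d \<Longrightarrow> dist (m x') (m x) < e"
    using m x e unfolding continuous_on_iff by blast
  have "dist (H x') (H x) < e" if "x' \<in> {0..1}" "dist x' x < d" for x'
    using d(2)[OF that] increments_below_abs_diff_le[OF H that(1) x] by (simp add: dist_real_def)
  then show "\<exists>d>0. \<forall>x'\<in>{0..1}. dist x' x < d \<longrightarrow> dist (H x') (H x) < e" using d(1) by blast
qed

text \<open>Truncation with \<open>min\<close> keeps only the part of the i-th cell to the left of
  t, so as a function of t this is constant outside the cell.\<close>

definition cell_increment :: "(real \<Rightarrow> real) \<Rightarrow> nat \<Rightarrow> nat \<Rightarrow> real \<Rightarrow> real" where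
  "cell_increment m n i t = m (min t (real (Suc i) / real n)) - m (min t (real i / real n))"

text \<open>A vertex \<open>x\<close> of the grid in an n-dimensional cube becomes a function that
  takes the fraction \<open>x i / n\<close> of the growth of \<open>m\<close> on cell i. The number
  of cells and the fineness of the grid are the same n.\<close>

definition weighted_increments :: "(real \<Rightarrow> real) \<Rightarrow> nat \<Rightarrow> (nat \<Rightarrow> nat) \<Rightarrow> real \<Rightarrow> real" where
  "weighted_increments m n x t = (\<Sum>i<n. real (x i) / real n * cell_increment m n i t)"

lemma cell_increment_mono:
  assumes m: "mono_on {0..1} m" and i: "i < n" and st: "0 \<le> s" "s \<le> t" "t \<le> 1"
  shows "cell_increment m n i s \<le> cell_increment m n i t"
proof -
  have le: "real i / real n \<le> real (Suc i) / real n" "real (Suc i) / real n \<le> 1" "0 \<le> real i / real n"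
    using i by (auto simp: divide_simps)
  have m': "m x \<le> m y" if "0 \<le> x" "x \<le> y" "y \<le> 1" for x y
    using m that by (auto simp: mono_on_def)
  show ?thesis
  proof (cases "s \<le> real i / real n")
    case True
    then have "cell_increment m n i s = 0" using le by (simp add: cell_increment_def)
    moreover have "cell_increment m n i t \<ge> 0"
      unfolding cell_increment_def using m'[of "min t (real i / real n)" "min t (real (Suc i) / real n)"] le st
      by (auto simp: min_def split: if_splits)
    ultimately show ?thesis by simp
  next
    case False
    then show ?thesis
      unfolding cell_increment_def
      using m'[of "min s (real (Suc i) / real n)" "min t (real (Suc i) / real n)"] le st
      by (auto simp: min_def split: if_splits)
  qed
qed

lemma sum_cell_increment:
  assumes "0 < n" "0 \<le> t" "t \<le> 1"
  shows "(\<Sum>i<n. cell_increment m n i t) = m t - m 0"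
  unfolding cell_increment_def
  using sum_lessThan_telescope[of "\<lambda>i. m (min t (real i / real n))" n] assms by (simp add: min_def)

lemma cell_increment_0 [simp]: "cell_increment m n i 0 = 0"
  by (simp add: cell_increment_def min_def)

lemma cell_increment_cell:
  assumes "i < n" "j < n"
  shows "cell_increment m n j (real (Suc i) / real n) - cell_increment m n j (real i / real n)
    = (if j = i then m (real (Suc i) / real n) - m (real i / real n) else 0)"
proof -
  have mn: "min (real p / real n) (real q / real n) = real (min p q) / real n" for p q
    using assms by (auto simp: min_def divide_simps)
  consider "j < i" | "j = i" | "i < j" by linarith
  then show ?thesis
    unfolding cell_increment_def mn by cases (simp_all add: min_absorb1 min_absorb2)
qed

lemma weighted_increments_in:
  assumes m: "mono_on {0..1} m" and n: "0 < n" and x: "\<And>i. i < n \<Longrightarrow> x i \<le> n"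
  shows "weighted_increments m n x \<in> increments_below m"
  unfolding increments_below_def
proof (safe)
  show "weighted_increments m n x 0 = 0" by (simp add: weighted_increments_def)
  fix a b :: real assume ab: "0 \<le> a" "a \<le> b" "b \<le> 1"
  let ?d = "\<lambda>i. cell_increment m n i b - cell_increment m n i a"
  have d: "?d i \<ge> 0" if "i < n" for i using cell_increment_mono[OF m that ab] by simp
  have e: "weighted_increments m n x b - weighted_increments m n x a = (\<Sum>i<n. real (x i) / real n * ?d i)"
    by (simp add: weighted_increments_def sum_subtractf right_diff_distrib)
  show "0 \<le> weighted_increments m n x b - weighted_increments m n x a"
    unfolding e by (intro sum_nonneg mult_nonneg_nonneg d) auto
  have "(\<Sum>i<n. real (x i) / real n * ?d i) \<le> (\<Sum>i<n. ?d i)"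
    using d x n by (intro sum_mono mult_left_le_one_le) auto
  also have "\<dots> = m b - m a" using sum_cell_increment[OF n] ab by (simp add: sum_subtractf)
  finally show "weighted_increments m n x b - weighted_increments m n x a \<le> m b - m a" using e by simp
qed

lemma weighted_increments_cell:
  assumes i: "i < n"
  shows "weighted_increments m n x (real (Suc i) / real n) - weighted_increments m n x (real i / real n)
    = real (x i) / real n * (m (real (Suc i) / real n) - m (real i / real n))"
proof -
  have "weighted_increments m n x (real (Suc i) / real n) - weighted_increments m n x (real i / real n)
    = (\<Sum>j<n. real (x j) / real n *
        (cell_increment m n j (real (Suc i) / real n) - cell_increment m n j (real i / real n)))"
    by (simp only: weighted_increments_def sum_subtractf right_diff_distrib)
  also have "\<dots> = (\<Sum>j<n. if j = i then real (x j) / real n * (m (real (Suc i) / real n) - m (real i / real n)) else 0)"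
    by (rule sum.cong) (use i in \<open>auto simp only: cell_increment_cell lessThan_iff mult_zero_right split: if_splits\<close>)
  finally show ?thesis using i by simp
qed

text \<open>Moving each coordinate by at most one grid step changes each weight by at most 1/n, and
  the cell increments add up to at most \<open>m 1 - m 0\<close>. The bound therefore does not
  deteriorate with the dimension.\<close>

lemma weighted_increments_close:
  assumes m: "mono_on {0..1} m" and n: "0 < n" and t: "0 \<le> t" "t \<le> 1"
    and xq: "\<And>i. i < n \<Longrightarrow> q i \<le> x i \<and> x i \<le> q i + 1"
  shows "\<bar>weighted_increments m n x t - weighted_increments m n q t\<bar> \<le> (m 1 - m 0) / real n"
proof -
  have c: "cell_increment m n i t \<ge> 0" if "i < n" for i
    using cell_increment_mono[OF m that, of 0 t] t by simp
  have "weighted_increments m n x t - weighted_increments m n q t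
      = (\<Sum>i<n. (real (x i) - real (q i)) / real n * cell_increment m n i t)"
    by (simp add: weighted_increments_def sum_subtractf left_diff_distrib diff_divide_distrib)
  also have "\<bar>\<dots>\<bar> \<le> (\<Sum>i<n. 1 / real n * cell_increment m n i t)"
  proof (rule order_trans[OF sum_abs sum_mono])
    fix i assume i: "i \<in> {..<n}"
    have "\<bar>real (x i) - real (q i)\<bar> \<le> 1" using xq[of i] i by auto
    then show "\<bar>(real (x i) - real (q i)) / real n * cell_increment m n i t\<bar> \<le> 1 / real n * cell_increment m n i t"
      unfolding abs_mult using c[of i] i by (intro mult_mono) (auto simp: divide_right_mono)
  qed
  also have "\<dots> = (m t - m 0) / real n"
    using sum_cell_increment[OF n t, of m] by (simp add: sum_divide_distrib[symmetric])
  also have "\<dots> \<le> (m 1 - m 0) / real n"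
    using m t by (intro divide_right_mono) (auto simp: mono_on_def)
  finally show ?thesis .
qed

text \<open>A discontinuous Brouwer-type theorem: the operator \<open>\<Lambda>\<close> need not be continuous, at the price
  that each cell has its own pair of nearby sub- and supersolutions.\<close>

lemma kuhn_increments:
  fixes \<Lambda> :: "(real \<Rightarrow> real) \<Rightarrow> nat \<Rightarrow> real"
  assumes m: "mono_on {0..1} m" and n: "0 < n"
    and \<Lambda>: "\<And>H i. H \<in> increments_below m \<Longrightarrow> i < n \<Longrightarrow>
        0 \<le> \<Lambda> H i \<and> \<Lambda> H i \<le> m (real (Suc i) / real n) - m (real i / real n)"
  obtains F Hp Hm where "F \<in> increments_below m"
    and "\<And>i. Hp i \<in> increments_below m" "\<And>i. Hm i \<in> increments_below m"
    and "\<And>i t. t \<in> {0..1} \<Longrightarrow> \<bar>Hp i t - F t\<bar> \<le> (m 1 - m 0) / real n"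
    and "\<And>i t. t \<in> {0..1} \<Longrightarrow> \<bar>Hm i t - F t\<bar> \<le> (m 1 - m 0) / real n"
    and "\<And>i. i < n \<Longrightarrow> F (real (Suc i) / real n) - F (real i / real n) \<le> \<Lambda> (Hp i) i"
    and "\<And>i. i < n \<Longrightarrow> \<Lambda> (Hm i) i \<le> F (real (Suc i) / real n) - F (real i / real n)
           + (m (real (Suc i) / real n) - m (real i / real n)) / real n"
proof -
  let ?W = "weighted_increments m n"
  let ?inc = "\<lambda>H i. H (real (Suc i) / real n) - H (real i / real n)"
  have W_in: "?W x \<in> increments_below m" if "\<forall>i<n. x i \<le> n" for x
    using weighted_increments_in[OF m n] that by blast
  have W_inc: "?inc (?W x) i = real (x i) / real n * ?inc m i" if "i < n" for x i
    by (rule weighted_increments_cell[OF that])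
  have m_inc: "0 \<le> ?inc m i" if "i < n" for i
    using \<Lambda>[OF W_in[of "\<lambda>_. 0"] that] by auto
  \<comment> \<open>Label 0 says that \<Lambda> asks for at least the present increment in direction
    i. The condition \<open>x i < n\<close> forces label 1 on the upper face, and nonnegativity of
    \<Lambda> gives label 0 on the lower face.\<close>
  define label where "label x i = (if x i < n \<and> ?inc (?W x) i \<le> \<Lambda> (?W x) i then 0 else 1::nat)" for x i
  obtain q where q: "\<forall>i<n. q i < n"
    and rs: "\<forall>i<n. \<exists>r s. (\<forall>j<n. q j \<le> r j \<and> r j \<le> q j + 1) \<and> (\<forall>j<n. q j \<le> s j \<and> s j \<le> q j + 1)
        \<and> label r i \<noteq> label s i"
  proof (rule kuhn_lemma[OF n, of n label])
    show "\<forall>x. (\<forall>i<n. x i \<le> n) \<longrightarrow> (\<forall>i<n. label x i = 0 \<or> label x i = 1)"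
      by (simp add: label_def)
    show "\<forall>x. (\<forall>i<n. x i \<le> n) \<longrightarrow> (\<forall>i<n. x i = 0 \<longrightarrow> label x i = 0)"
    proof (intro allI impI)
      fix x :: "nat \<Rightarrow> nat" and i assume x: "\<forall>i<n. x i \<le> n" "i < n" "x i = 0"
      have "?inc (?W x) i = 0" using W_inc[OF x(2), of x] x(3) by simp
      then show "label x i = 0" using \<Lambda>[OF W_in[OF x(1)] x(2)] x(3) n by (simp add: label_def)
    qed
    show "\<forall>x. (\<forall>i<n. x i \<le> n) \<longrightarrow> (\<forall>i<n. x i = n \<longrightarrow> label x i = 1)"
      by (simp add: label_def)
  qed (use that in auto)
  define near where "near x \<longleftrightarrow> (\<forall>j<n. q j \<le> x j \<and> x j \<le> q j + 1)" for x
  have near_le: "\<forall>j<n. x j \<le> n" if "near x" for x using q that unfolding near_def by force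
  have near_ex: "\<exists>x. near x \<and> label x i = l" if i: "i < n" and l: "l = 0 \<or> l = 1" for i l
  proof -
    from rs i obtain r s where *: "near r" "near s" "label r i \<noteq> label s i" unfolding near_def by blast
    have "label x i = 0 \<or> label x i = 1" for x by (simp add: label_def)
    then show ?thesis using * l by metis
  qed
  \<comment> \<open>In each direction the small cube at \<open>q\<close> has vertices of both
    labels. Indices beyond the grid get \<open>q\<close> itself, so that membership and closeness
    hold for every i.\<close>
  define up where "up i = (if i < n then SOME x. near x \<and> label x i = 0 else q)" for i
  define lo where "lo i = (if i < n then SOME x. near x \<and> label x i = 1 else q)" for i
  have near_q: "near q" by (simp add: near_def)
  have up: "near (up i) \<and> label (up i) i = 0" if "i < n" for i
    unfolding up_def using someI_ex[OF near_ex[OF that, of 0]] that by simp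
  have lo: "near (lo i) \<and> label (lo i) i = 1" if "i < n" for i
    unfolding lo_def using someI_ex[OF near_ex[OF that, of 1]] that by simp
  have near: "near (up i)" "near (lo i)" for i
    using up lo near_q by (cases "i < n"; auto simp: up_def lo_def)+
  have close: "\<bar>?W x t - ?W q t\<bar> \<le> (m 1 - m 0) / real n" if "near x" "t \<in> {0..1}" for x t
    by (rule weighted_increments_close[OF m n]) (use that in \<open>auto simp: near_def\<close>)
  show ?thesis
  proof (rule that[of "?W q" "\<lambda>i. ?W (up i)" "\<lambda>i. ?W (lo i)"])
    show "?W q \<in> increments_below m" "\<And>i. ?W (up i) \<in> increments_below m" "\<And>i. ?W (lo i) \<in> increments_below m"
      using near near_q near_le W_in by blast+
    show "\<And>i t. t \<in> {0..1} \<Longrightarrow> \<bar>?W (up i) t - ?W q t\<bar> \<le> (m 1 - m 0) / real n"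
      "\<And>i t. t \<in> {0..1} \<Longrightarrow> \<bar>?W (lo i) t - ?W q t\<bar> \<le> (m 1 - m 0) / real n"
      using close near by blast+
    fix i assume i: "i < n"
    have "?inc (?W q) i \<le> ?inc (?W (up i)) i"
      unfolding W_inc[OF i] using near(1)[of i] i m_inc[OF i]
      by (intro mult_right_mono divide_right_mono) (auto simp: near_def)
    also have "\<dots> \<le> \<Lambda> (?W (up i)) i" using up[OF i] by (simp add: label_def split: if_splits)
    finally show "?inc (?W q) i \<le> \<Lambda> (?W (up i)) i" .
    \<comment> \<open>Label 1 has two causes: either \<Lambda> is below the present increment, or
      the coordinate is already n. In the second case the increment is that of \<open>m\<close>,
      which bounds \<Lambda> by hypothesis.\<close>
    have "\<Lambda> (?W (lo i)) i \<le> ?inc (?W (lo i)) i"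
    proof (cases "lo i i < n")
      case True
      then show ?thesis using lo[OF i] by (simp add: label_def split: if_splits)
    next
      case False
      then have "lo i i = n" using near_le[OF near(2)[of i]] i by (meson le_antisym not_less)
      then have "?inc (?W (lo i)) i = ?inc m i" using W_inc[OF i, of "lo i"] n by simp
      then show ?thesis using \<Lambda>[OF W_in[OF near_le[OF near(2)[of i]]] i] by simp
    qed
    \<comment> \<open>A vertex of the cube may exceed \<open>q\<close> by one step in direction i;
      this step is the error term of the conclusion.\<close>
    also have "\<dots> \<le> (real (q i) + 1) / real n * ?inc m i"
      unfolding W_inc[OF i] using near(2)[of i] i m_inc[OF i]
      by (intro mult_right_mono divide_right_mono) (auto simp: near_def)
    also have "\<dots> = ?inc (?W q) i + ?inc m i / real n"
      unfolding W_inc[OF i] by (simp add: add_divide_distrib distrib_right)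
    finally show "\<Lambda> (?W (lo i)) i \<le> ?inc (?W q) i + ?inc m i / real n" .
  qed
qed

text \<open>Both end points are rounded down to the grid. Of the four resulting errors, two have the
  right sign by monotonicity of \<open>F\<close> and \<open>P\<close>, and the other two are at most
  the oscillation of \<open>m\<close> over one cell.\<close>

lemma increments_le_of_grid:
  assumes F: "F \<in> increments_below m" and P: "P \<in> increments_below m" and N: "0 < N"
    and grid: "\<And>p q. p \<le> q \<Longrightarrow> q \<le> N \<Longrightarrow>
        F (real q / real N) - F (real p / real N) \<le> P (real q / real N) - P (real p / real N) + c"
    and osc: "\<And>x y. x \<in> {0..1} \<Longrightarrow> y \<in> {0..1} \<Longrightarrow> \<bar>x - y\<bar> \<le> 1 / real N \<Longrightarrow> \<bar>m x - m y\<bar> \<le> \<epsilon>"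
    and ab: "0 \<le> a" "a \<le> b" "b \<le> 1"
  shows "F b - F a \<le> P b - P a + c + 2 * \<epsilon>"
proof -
  define g where "g x = nat \<lfloor>real N * x\<rfloor>" for x :: real
  have g: "real (g x) / real N \<le> x \<and> x - real (g x) / real N \<le> 1 / real N \<and> 0 \<le> real (g x) / real N"
    if "0 \<le> x" for x
  proof -
    have "real (g x) = of_int \<lfloor>real N * x\<rfloor>" unfolding g_def using that N by simp
    then have "real (g x) \<le> real N * x" "real N * x \<le> real (g x) + 1" by linarith+
    then have "real (g x) / real N \<le> x" "x \<le> (real (g x) + 1) / real N"
      using N by (simp_all add: field_simps)
    then show ?thesis by (simp add: add_divide_distrib)
  qed
  have gab: "g a \<le> g b" unfolding g_def using ab N by (intro nat_mono floor_mono) auto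
  have gb: "g b \<le> N" 
  proof -
    have "real (g b) / real N \<le> 1" using g[of b] ab by linarith
    then show ?thesis using N by simp
  qed
  note 1 = grid[OF gab gb]
  let ?ga = "real (g a) / real N" and ?gb = "real (g b) / real N"
  have a: "0 \<le> ?ga" "?ga \<le> a" "a - ?ga \<le> 1 / real N" and b: "0 \<le> ?gb" "?gb \<le> b" "b - ?gb \<le> 1 / real N"
    using g[of a] g[of b] ab by auto
  have "F b - F ?gb \<le> \<epsilon>" "P a - P ?ga \<le> \<epsilon>"
    using increments_belowD(3)[OF F, of ?gb b] osc[of b ?gb] increments_belowD(3)[OF P, of ?ga a] osc[of a ?ga]
      a b ab by auto
  moreover have "F ?ga \<le> F a" "P ?gb \<le> P b"
    using increments_belowD(2)[OF F, of ?ga a] increments_belowD(2)[OF P, of ?gb b] a b ab by auto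
  ultimately show ?thesis using 1 by linarith
qed

text \<open>Kuhn's lemma provides a different function for every cell; the floor selects the one for
  the cell containing s. On each closed cell the selection is wrong at most at the right end point,
  a null set.\<close>

lemma glue_cells:
  fixes g :: "nat \<Rightarrow> real \<Rightarrow> real"
  assumes N: "0 < N" and g: "\<And>i. g i absolutely_integrable_on {0..1}"
  defines "h \<equiv> \<lambda>s::real. g (nat \<lfloor>real N * s\<rfloor>) s"
  shows "h absolutely_integrable_on {0..1}"
    and "\<And>i. i < N \<Longrightarrow> integral {real i / real N..real (Suc i) / real N} h
           = integral {real i / real N..real (Suc i) / real N} (g i)"
proof -
  let ?C = "\<lambda>i. {real i / real N..real (Suc i) / real N}"
  have eq: "h s = g i s" if "s \<in> ?C i - {real (Suc i) / real N}" for i s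
  proof -
    have "real i \<le> real N * s" "real N * s < real i + 1"
      using that N by (auto simp: field_simps)
    then have "\<lfloor>real N * s\<rfloor> = int i" by linarith
    then show ?thesis by (simp add: h_def)
  qed
  have gC: "g i absolutely_integrable_on ?C i" if "i < N" for i
    by (rule absolutely_integrable_on_subinterval[OF g]) (use that N in \<open>auto simp: field_simps\<close>)
  have hC: "h absolutely_integrable_on ?C i" if "i < N" for i
    by (rule absolutely_integrable_spike[OF gC[OF that], of "{real (Suc i) / real N}"]) (use eq in auto)
  show "integral (?C i) h = integral (?C i) (g i)" if "i < N" for i
    by (rule integral_spike[of "{real (Suc i) / real N}"]) (use eq in auto)
  have "h absolutely_integrable_on {0..real j / real N}" if "j \<le> N" for j
    using that
  proof (induction j)
    case 0
    then show ?case using absolutely_integrable_on_null[of 0 "0::real" h] by simp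
  next
    case (Suc j)
    show ?case
    proof (rule absolutely_integrable_on_combine[where c="real j / real N"])
      show "h absolutely_integrable_on {0..real j / real N}" "h absolutely_integrable_on ?C j"
        using Suc hC by simp_all
    qed (auto simp: divide_right_mono)
  qed
  from this[of N] show "h absolutely_integrable_on {0..1}" using N by simp
qed

section \<open>Approximate solutions and their limit\<close>

lemma integral_mono_AE_interval:
  fixes f g :: "real \<Rightarrow> real"
  assumes f: "f absolutely_integrable_on {a..b}" and g: "g absolutely_integrable_on {a..b}"
    and le: "AE s in lebesgue. s \<in> {a..b} \<longrightarrow> f s \<le> g s"
  shows "integral {a..b} f \<le> integral {a..b} g"
proof -
  have "(LINT s:{a..b}|lebesgue. f s) \<le> (LINT s:{a..b}|lebesgue. g s)"
    using f g unfolding set_integrable_def set_lebesgue_integral_def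
    by (rule integral_mono_AE) (rule eventually_mono[OF le], simp add: indicator_def)
  then show ?thesis using f g by (simp add: set_lebesgue_integral_eq_integral)
qed

lemma integral_in_increments_below:
  fixes h M :: "real \<Rightarrow> real"
  assumes h: "h absolutely_integrable_on {0..1}" and M: "M absolutely_integrable_on {0..1}"
    and hM: "AE s in lebesgue. s \<in> {0..1} \<longrightarrow> 0 \<le> h s \<and> h s \<le> M s"
  shows "(\<lambda>t. integral {0..t} h) \<in> increments_below (\<lambda>t. integral {0..t} M)"
  unfolding increments_below_def
proof (safe)
  fix a b :: real assume ab: "0 \<le> a" "a \<le> b" "b \<le> 1"
  note int = set_lebesgue_integral_eq_integral(1)
  have sub: "h absolutely_integrable_on {a..b}" "M absolutely_integrable_on {a..b}"
    by (rule absolutely_integrable_on_subinterval[OF h] absolutely_integrable_on_subinterval[OF M]; use ab in simp)+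
  have "integral {a..b} (\<lambda>_. 0) \<le> integral {a..b} h"
    by (rule integral_mono_AE_interval[OF _ sub(1)], simp, rule eventually_mono[OF hM]) (use ab in auto)
  then show "0 \<le> integral {0..b} h - integral {0..a} h"
    using integral_increment[OF int[OF h] ab] by simp
  have "integral {a..b} h \<le> integral {a..b} M"
    by (rule integral_mono_AE_interval[OF sub], rule eventually_mono[OF hM]) (use ab in auto)
  then show "integral {0..b} h - integral {0..a} h \<le> integral {0..b} M - integral {0..a} M"
    using integral_increment[OF int[OF h] ab] integral_increment[OF int[OF M] ab] by simp
qed simp

text \<open>Kuhn's lemma is applied to the cell integrals of \<open>\<Phi> H\<close>, and the chosen
  functions are glued into the densities \<open>hp\<close> and \<open>hm\<close>. Of these it
  suffices to record that each value is a value of some \<open>\<Phi> (Hp i)\<close> or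
  \<open>\<Phi> (Hm i)\<close>, because the closeness to \<open>F\<close> is uniform in i. The error
  \<open>m 1 / N\<close> comes from the vertices, the error 2\<epsilon> from rounding to the
  grid.\<close>

lemma approximate_solution:
  fixes M :: "real \<Rightarrow> real" and \<Phi> :: "(real \<Rightarrow> real) \<Rightarrow> real \<Rightarrow> real"
  assumes M: "M absolutely_integrable_on {0..1}" and M0: "\<And>s. s \<in> {0..1} \<Longrightarrow> 0 \<le> M s"
    and m_def: "m = (\<lambda>t. integral {0..t} M)" and N: "0 < N"
    and \<Phi>: "\<And>H. H \<in> increments_below m \<Longrightarrow> \<Phi> H absolutely_integrable_on {0..1}"
    and \<Phi>M: "\<And>H. H \<in> increments_below m \<Longrightarrow>
        AE s in lebesgue. s \<in> {0..1} \<longrightarrow> 0 \<le> \<Phi> H s \<and> \<Phi> H s \<le> M s"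
  shows "\<exists>F Hp Hm hp hm. F \<in> increments_below m
    \<and> (\<forall>i. Hp i \<in> increments_below m \<and> Hm i \<in> increments_below m
        \<and> (\<forall>t\<in>{0..1}. \<bar>Hp i t - F t\<bar> \<le> m 1 / real N \<and> \<bar>Hm i t - F t\<bar> \<le> m 1 / real N))
    \<and> hp absolutely_integrable_on {0..1} \<and> hm absolutely_integrable_on {0..1}
    \<and> (\<forall>s. \<exists>i::nat. hp s = \<Phi> (Hp i) s) \<and> (\<forall>s. \<exists>i::nat. hm s = \<Phi> (Hm i) s)
    \<and> (\<forall>\<epsilon>. (\<forall>x\<in>{0..1}. \<forall>y\<in>{0..1}. \<bar>x - y\<bar> \<le> 1 / real N \<longrightarrow> \<bar>m x - m y\<bar> \<le> \<epsilon>) \<longrightarrow>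
        (\<forall>a b. 0 \<le> a \<longrightarrow> a \<le> b \<longrightarrow> b \<le> 1 \<longrightarrow>
          F b - F a \<le> integral {a..b} hp + 2 * \<epsilon>
          \<and> integral {a..b} hm \<le> F b - F a + m 1 / real N + 2 * \<epsilon>))"
proof -
  note int = set_lebesgue_integral_eq_integral(1)
  have AE_M: "AE s in lebesgue. s \<in> {0..1} \<longrightarrow> 0 \<le> M s \<and> M s \<le> M s" using M0 by simp
  have m_in: "m \<in> increments_below m"
    using integral_in_increments_below[OF M M AE_M] by (simp add: m_def)
  have m: "mono_on {0..1} m" using increments_belowD(2)[OF m_in] by (auto simp: mono_on_def)
  have m0: "m 0 = 0" by (rule increments_belowD(1)[OF m_in])
  let ?l = "\<lambda>i. real i / real N" and ?u = "\<lambda>i. real (Suc i) / real N"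
  define \<Lambda> where "\<Lambda> H i = integral {?l i..?u i} (\<Phi> H)" for H i
  have cell: "0 \<le> ?l i" "?l i \<le> ?u i" "?u i \<le> 1" if "i < N" for i
    using that by (auto simp: divide_simps)
  have \<Lambda>_eq: "\<Lambda> H i = integral {0..?u i} (\<Phi> H) - integral {0..?l i} (\<Phi> H)"
    if "H \<in> increments_below m" "i < N" for H i
    unfolding \<Lambda>_def using integral_increment[OF int[OF \<Phi>[OF that(1)]] cell[OF that(2)]] by simp
  have \<Phi>_in: "(\<lambda>t. integral {0..t} (\<Phi> H)) \<in> increments_below m" if "H \<in> increments_below m" for H
    using integral_in_increments_below[OF \<Phi>[OF that] M \<Phi>M[OF that]] by (simp add: m_def)
  have \<Lambda>: "0 \<le> \<Lambda> H i \<and> \<Lambda> H i \<le> m (?u i) - m (?l i)" if "H \<in> increments_below m" "i < N" for H i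
    using increments_belowD(2,3)[OF \<Phi>_in[OF that(1)] cell[OF that(2)]] \<Lambda>_eq[OF that] by simp
  obtain F Hp Hm where F: "F \<in> increments_below m"
    and H_in: "\<And>i. Hp i \<in> increments_below m" "\<And>i. Hm i \<in> increments_below m"
    and close: "\<And>i t. t \<in> {0..1} \<Longrightarrow> \<bar>Hp i t - F t\<bar> \<le> (m 1 - m 0) / real N"
      "\<And>i t. t \<in> {0..1} \<Longrightarrow> \<bar>Hm i t - F t\<bar> \<le> (m 1 - m 0) / real N"
    and le: "\<And>i. i < N \<Longrightarrow> F (?u i) - F (?l i) \<le> \<Lambda> (Hp i) i"
    and ge: "\<And>i. i < N \<Longrightarrow> \<Lambda> (Hm i) i \<le> F (?u i) - F (?l i) + (m (?u i) - m (?l i)) / real N"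
  proof (rule kuhn_increments[OF m N, of \<Lambda>], goal_cases)
    case (1 H i)
    show ?case using 1(2,3) by (rule \<Lambda>)
  next
    case (2 F Hp Hm)
    show thesis by (rule that[of F Hp Hm]) (fact 2)+
  qed
  define hp where "hp = (\<lambda>s::real. \<Phi> (Hp (nat \<lfloor>real N * s\<rfloor>)) s)"
  define hm where "hm = (\<lambda>s::real. \<Phi> (Hm (nat \<lfloor>real N * s\<rfloor>)) s)"
  note glue_p = glue_cells[OF N, of "\<lambda>i. \<Phi> (Hp i)", OF \<Phi>[OF H_in(1)], folded hp_def]
  note glue_m = glue_cells[OF N, of "\<lambda>i. \<Phi> (Hm i)", OF \<Phi>[OF H_in(2)], folded hm_def]
  have AEp: "AE s in lebesgue. s \<in> {0..1} \<longrightarrow> 0 \<le> hp s \<and> hp s \<le> M s"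
    and AEm: "AE s in lebesgue. s \<in> {0..1} \<longrightarrow> 0 \<le> hm s \<and> hm s \<le> M s"
  proof -
    have "AE s in lebesgue. \<forall>i. s \<in> {0..1} \<longrightarrow> 0 \<le> \<Phi> (Hp i) s \<and> \<Phi> (Hp i) s \<le> M s"
      unfolding AE_all_countable using \<Phi>M[OF H_in(1)] by blast
    then show "AE s in lebesgue. s \<in> {0..1} \<longrightarrow> 0 \<le> hp s \<and> hp s \<le> M s"
      by eventually_elim (simp add: hp_def)
    have "AE s in lebesgue. \<forall>i. s \<in> {0..1} \<longrightarrow> 0 \<le> \<Phi> (Hm i) s \<and> \<Phi> (Hm i) s \<le> M s"
      unfolding AE_all_countable using \<Phi>M[OF H_in(2)] by blast
    then show "AE s in lebesgue. s \<in> {0..1} \<longrightarrow> 0 \<le> hm s \<and> hm s \<le> M s"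
      by eventually_elim (simp add: hm_def)
  qed
  define P where "P t = integral {0..t} hp" for t
  define Q where "Q t = integral {0..t} hm" for t
  have P: "P \<in> increments_below m" and Q: "Q \<in> increments_below m"
    using integral_in_increments_below[OF glue_p(1) M AEp] integral_in_increments_below[OF glue_m(1) M AEm]
    by (simp_all add: P_def[abs_def] Q_def[abs_def] m_def)
  have P_inc: "P b - P a = integral {a..b} hp" and Q_inc: "Q b - Q a = integral {a..b} hm"
    if "0 \<le> a" "a \<le> b" "b \<le> 1" for a b
    using integral_increment[OF int[OF glue_p(1)] that] integral_increment[OF int[OF glue_m(1)] that]
    by (simp_all add: P_def Q_def)
  have cellP: "F (?u i) - F (?l i) \<le> P (?u i) - P (?l i)" if "i < N" for i
    using le[OF that] glue_p(2)[OF that] P_inc[OF cell[OF that]] by (simp add: \<Lambda>_def)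
  have cellQ: "Q (?u i) - Q (?l i) \<le> F (?u i) - F (?l i) + (m (?u i) - m (?l i)) / real N" if "i < N" for i
    using ge[OF that] glue_m(2)[OF that] Q_inc[OF cell[OF that]] by (simp add: \<Lambda>_def)
  have gridP: "F (?l q) - F (?l p) \<le> P (?l q) - P (?l p) + 0" if "p \<le> q" "q \<le> N" for p q
    using that
  proof (induction q rule: dec_induct)
    case (step k)
    then show ?case using cellP[of k] by simp
  qed simp
  \<comment> \<open>The errors are kept proportional to increments of \<open>m\<close>: they
    telescope along the grid, so all N cells together cost no more than
    \<open>m 1 / N\<close>.\<close>
  have gridQ0: "Q (?l q) - Q (?l p) \<le> F (?l q) - F (?l p) + (m (?l q) - m (?l p)) / real N"
    if "p \<le> q" "q \<le> N" for p q
    using that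
  proof (induction q rule: dec_induct)
    case (step k)
    then show ?case using cellQ[of k] by (simp add: diff_divide_distrib)
  qed simp
  have gridQ: "Q (?l q) - Q (?l p) \<le> F (?l q) - F (?l p) + m 1 / real N" if "p \<le> q" "q \<le> N" for p q
  proof -
    have "?l q \<le> 1" "0 \<le> ?l p" "0 \<le> ?l q" "?l p \<le> 1" using that N by (auto simp: divide_simps)
    then have "m (?l q) - m (?l p) \<le> m 1"
      using increments_belowD(2)[OF m_in, of "?l q" 1] increments_belowD(2)[OF m_in, of 0 "?l p"] m0 by simp
    then have "(m (?l q) - m (?l p)) / real N \<le> m 1 / real N" by (rule divide_right_mono) simp
    then show ?thesis using gridQ0[OF that] by linarith
  qed
  have main: "F b - F a \<le> integral {a..b} hp + 2 * \<epsilon> \<and> integral {a..b} hm \<le> F b - F a + m 1 / real N + 2 * \<epsilon>"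
    if osc: "\<forall>x\<in>{0..1}. \<forall>y\<in>{0..1}. \<bar>x - y\<bar> \<le> 1 / real N \<longrightarrow> \<bar>m x - m y\<bar> \<le> \<epsilon>"
      and ab: "0 \<le> a" "a \<le> b" "b \<le> 1" for \<epsilon> a b
  proof
    have osc': "\<And>x y. x \<in> {0..1} \<Longrightarrow> y \<in> {0..1} \<Longrightarrow> \<bar>x - y\<bar> \<le> 1 / real N \<Longrightarrow> \<bar>m x - m y\<bar> \<le> \<epsilon>"
      using osc by blast
    have "F b - F a \<le> P b - P a + 0 + 2 * \<epsilon>"
      by (rule increments_le_of_grid[OF F P N _ _ ab]) (fact gridP, fact osc')
    then show "F b - F a \<le> integral {a..b} hp + 2 * \<epsilon>" using P_inc[OF ab] by simp
    have "Q b - Q a \<le> F b - F a + m 1 / real N + 2 * \<epsilon>"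
      by (rule increments_le_of_grid[OF Q F N _ _ ab]) (fact gridQ, fact osc')
    then show "integral {a..b} hm \<le> F b - F a + m 1 / real N + 2 * \<epsilon>" using Q_inc[OF ab] by simp
  qed
  show ?thesis
  proof (intro exI conjI)
    show "F \<in> increments_below m" by (rule F)
    show "\<forall>i. Hp i \<in> increments_below m \<and> Hm i \<in> increments_below m
        \<and> (\<forall>t\<in>{0..1}. \<bar>Hp i t - F t\<bar> \<le> m 1 / real N \<and> \<bar>Hm i t - F t\<bar> \<le> m 1 / real N)"
      using H_in close m0 by auto
    show "hp absolutely_integrable_on {0..1}" "hm absolutely_integrable_on {0..1}"
      by (rule glue_p(1), rule glue_m(1))
    show "\<forall>s. \<exists>i::nat. hp s = \<Phi> (Hp i) s" "\<forall>s. \<exists>i::nat. hm s = \<Phi> (Hm i) s"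
      by (auto simp: hp_def hm_def)
  qed (use main in blast)
qed

text \<open>All \<open>F n\<close> share the modulus of continuity of \<open>m\<close>, so
  Arzela-Ascoli applies although no continuity of \<Phi> is assumed. The operator may change with n,
  which leaves room for perturbations that vanish in the limit.\<close>

lemma limit_solution:
  fixes M :: "real \<Rightarrow> real" and \<Phi> :: "nat \<Rightarrow> (real \<Rightarrow> real) \<Rightarrow> real \<Rightarrow> real"
  assumes M: "M absolutely_integrable_on {0..1}" and M0: "\<And>s. s \<in> {0..1} \<Longrightarrow> 0 \<le> M s"
    and m_def: "m = (\<lambda>t. integral {0..t} M)"
    and \<Phi>: "\<And>n H. H \<in> increments_below m \<Longrightarrow> \<Phi> n H absolutely_integrable_on {0..1}"
    and \<Phi>M: "\<And>n H. H \<in> increments_below m \<Longrightarrow>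
        AE s in lebesgue. s \<in> {0..1} \<longrightarrow> 0 \<le> \<Phi> n H s \<and> \<Phi> n H s \<le> M s"
  obtains H k Hp Hm hp hm where "H \<in> increments_below m" "strict_mono (k :: nat \<Rightarrow> nat)"
    and "\<And>n i. Hp n i \<in> increments_below m" "\<And>n i. Hm n i \<in> increments_below m"
    and "\<And>n. hp n absolutely_integrable_on {0..1}" "\<And>n. hm n absolutely_integrable_on {0..1}"
    and "\<And>n s. \<exists>i::nat. hp n s = \<Phi> (k n) (Hp n i) s" "\<And>n s. \<exists>i::nat. hm n s = \<Phi> (k n) (Hm n i) s"
    and "\<And>\<epsilon>. 0 < \<epsilon> \<Longrightarrow> \<forall>\<^sub>F n in sequentially.
        (\<forall>i. \<forall>t\<in>{0..1}. \<bar>Hp n i t - H t\<bar> \<le> \<epsilon> \<and> \<bar>Hm n i t - H t\<bar> \<le> \<epsilon>)"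
    and "\<And>\<epsilon>. 0 < \<epsilon> \<Longrightarrow> \<forall>\<^sub>F n in sequentially.
        (\<forall>a b. 0 \<le> a \<longrightarrow> a \<le> b \<longrightarrow> b \<le> 1 \<longrightarrow>
          H b - H a \<le> integral {a..b} (hp n) + \<epsilon> \<and> integral {a..b} (hm n) \<le> H b - H a + \<epsilon>)"
proof -
  have AE_M: "AE s in lebesgue. s \<in> {0..1} \<longrightarrow> 0 \<le> M s \<and> M s \<le> M s" using M0 by simp
  have m_in: "m \<in> increments_below m"
    using integral_in_increments_below[OF M M AE_M] by (simp add: m_def)
  have m_cont: "continuous_on {0..1} m"
    unfolding m_def by (rule indefinite_integral_continuous_1[OF set_lebesgue_integral_eq_integral(1)[OF M]])
  then have m_uc: "uniformly_continuous_on {0..1} m" by (rule compact_uniformly_continuous) simp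
  have m1: "0 \<le> m 1" using increments_belowD(1)[OF m_in] increments_belowD(2)[OF m_in, of 0 1] by simp
  define sol where "sol n F Hp Hm hp hm \<longleftrightarrow> F \<in> increments_below m
    \<and> (\<forall>i. Hp i \<in> increments_below m \<and> Hm i \<in> increments_below m
        \<and> (\<forall>t\<in>{0..1}. \<bar>Hp i t - F t\<bar> \<le> m 1 / real (Suc n) \<and> \<bar>Hm i t - F t\<bar> \<le> m 1 / real (Suc n)))
    \<and> hp absolutely_integrable_on {0..1} \<and> hm absolutely_integrable_on {0..1}
    \<and> (\<forall>s. \<exists>i::nat. hp s = \<Phi> n (Hp i) s) \<and> (\<forall>s. \<exists>i::nat. hm s = \<Phi> n (Hm i) s)
    \<and> (\<forall>\<epsilon>. (\<forall>x\<in>{0..1}. \<forall>y\<in>{0..1}. \<bar>x - y\<bar> \<le> 1 / real (Suc n) \<longrightarrow> \<bar>m x - m y\<bar> \<le> \<epsilon>) \<longrightarrow>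
        (\<forall>a b. 0 \<le> a \<longrightarrow> a \<le> b \<longrightarrow> b \<le> 1 \<longrightarrow>
          F b - F a \<le> integral {a..b} hp + 2 * \<epsilon>
          \<and> integral {a..b} hm \<le> F b - F a + m 1 / real (Suc n) + 2 * \<epsilon>))" for n F Hp Hm hp hm
  have "\<forall>n. \<exists>F Hp Hm hp hm. sol n F Hp Hm hp hm"
    unfolding sol_def by (intro allI approximate_solution[OF M M0 m_def zero_less_Suc \<Phi> \<Phi>M])
  then obtain F Hp Hm hp hm where sol: "\<And>n. sol n (F n) (Hp n) (Hm n) (hp n) (hm n)"
    unfolding choice_iff by blast
  note s1 = sol[unfolded sol_def]
  note s2 = conjunct2[OF s1]
  note s3 = conjunct2[OF s2]
  note s4 = conjunct2[OF s3]
  note s5 = conjunct2[OF s4]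
  note s6 = conjunct2[OF s5]
  note F = conjunct1[OF s1] and H = spec[OF conjunct1[OF s2]] and h_int = conjunct1[OF s3] conjunct1[OF s4]
    and h_eq = spec[OF conjunct1[OF s5]] spec[OF conjunct1[OF s6]]
  note H_in = conjunct1[OF H] conjunct1[OF conjunct2[OF H]]
  have close: "\<bar>Hp n i t - F n t\<bar> \<le> m 1 / real (Suc n)" "\<bar>Hm n i t - F n t\<bar> \<le> m 1 / real (Suc n)"
    if "t \<in> {0..1}" for n i t
    using bspec[OF conjunct2[OF conjunct2[OF H]] that] by simp_all
  have inc: "F n b - F n a \<le> integral {a..b} (hp n) + 2 * \<epsilon>
          \<and> integral {a..b} (hm n) \<le> F n b - F n a + m 1 / real (Suc n) + 2 * \<epsilon>"
    if "\<forall>x\<in>{0..1}. \<forall>y\<in>{0..1}. \<bar>x - y\<bar> \<le> 1 / real (Suc n) \<longrightarrow> \<bar>m x - m y\<bar> \<le> \<epsilon>"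
      "0 \<le> a" "a \<le> b" "b \<le> 1" for n \<epsilon> a b
    using spec[OF conjunct2[OF s6], of n \<epsilon>] that by simp
  obtain H k where k: "strict_mono (k :: nat \<Rightarrow> nat)"
    and lim: "\<And>e. 0 < e \<Longrightarrow> \<exists>N. \<forall>n x. n \<ge> N \<and> x \<in> {0..1} \<longrightarrow> norm (F (k n) x - H x) < e"
  proof (rule Arzela_Ascoli[of "{0..1}" F "m 1"])
    fix n and x :: real assume x: "x \<in> {0..1}"
    have "\<bar>F n x - F n 0\<bar> \<le> \<bar>m x - m 0\<bar>" by (rule increments_below_abs_diff_le[OF F x]) simp
    then show "norm (F n x) \<le> m 1"
      using increments_belowD(1)[OF F, of n] increments_belowD(1)[OF m_in] increments_belowD(2)[OF m_in, of x 1]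
        increments_belowD(2)[OF m_in, of 0 x] x by auto
  next
    fix x e :: real assume x: "x \<in> {0..1}" and e: "0 < e"
    obtain d where d: "d > 0" "\<And>x'. x' \<in> {0..1} \<Longrightarrow> dist x' x < d \<Longrightarrow> dist (m x') (m x) < e"
      using m_cont x e unfolding continuous_on_iff by blast
    have "norm (F n x - F n y) < e" if "y \<in> {0..1}" "norm (x - y) < d" for n y
      using d(2)[of y] increments_below_abs_diff_le[OF F that(1) x, of n] that
      by (simp add: dist_real_def abs_minus_commute)
    then show "\<exists>d>0. \<forall>n y. y \<in> {0..1} \<and> norm (x - y) < d \<longrightarrow> norm (F n x - F n y) < e"
      using d(1) by blast
  next
    fix g k assume "strict_mono (k :: nat \<Rightarrow> nat)"
      "\<And>e. 0 < e \<Longrightarrow> \<exists>N. \<forall>n x. n \<ge> N \<and> x \<in> {0..1} \<longrightarrow> norm (F (k n) x - g x) < e"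
    then show thesis by (rule that)
  qed simp
  have F_lim: "(\<lambda>n. F (k n) x) \<longlonglongrightarrow> H x" if "x \<in> {0..1}" for x
    unfolding LIMSEQ_iff using lim that by blast
  have H: "H \<in> increments_below m"
    unfolding increments_below_def
  proof (safe)
    show "H 0 = 0"
      using LIMSEQ_unique[OF F_lim[of 0]] increments_belowD(1)[OF F] by simp
    fix a b :: real assume ab: "0 \<le> a" "a \<le> b" "b \<le> 1"
    have l: "(\<lambda>n. F (k n) b - F (k n) a) \<longlonglongrightarrow> H b - H a"
      using ab by (intro tendsto_diff F_lim) auto
    show "0 \<le> H b - H a"
      by (rule LIMSEQ_le_const[OF l]) (use increments_belowD(2)[OF F ab] in auto)
    show "H b - H a \<le> m b - m a"
      by (rule LIMSEQ_le_const2[OF l]) (use increments_belowD(3)[OF F ab] in auto)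
  qed
  have ev_lim: "\<forall>\<^sub>F n in sequentially. \<forall>x\<in>{0..1}. \<bar>F (k n) x - H x\<bar> < e" if e: "0 < e" for e
  proof -
    obtain N where "\<forall>n x. n \<ge> N \<and> x \<in> {0..1} \<longrightarrow> norm (F (k n) x - H x) < e" using lim[OF e] by blast
    then show ?thesis by (intro eventually_sequentiallyI[of N] ballI) simp
  qed
  have k_top: "filterlim k sequentially sequentially" using k by (rule filterlim_subseq)
  have inv0: "(\<lambda>n. c / real (Suc (k n))) \<longlonglongrightarrow> 0" for c
    using filterlim_compose[OF LIMSEQ_Suc[OF lim_const_over_n[of c]] k_top] by simp
  have ev_inv: "\<forall>\<^sub>F n in sequentially. c / real (Suc (k n)) < e" if "0 < e" for c e
    using order_tendstoD(2)[OF inv0 that] by simp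
  show ?thesis
  proof (rule that[OF H k, of "\<lambda>n. Hp (k n)" "\<lambda>n. Hm (k n)" "\<lambda>n. hp (k n)" "\<lambda>n. hm (k n)"])
    fix \<epsilon> :: real assume \<epsilon>: "0 < \<epsilon>"
    then have h: "0 < \<epsilon> / 2" "0 < \<epsilon> / 8" by auto
    show "\<forall>\<^sub>F n in sequentially.
        (\<forall>i. \<forall>t\<in>{0..1}. \<bar>Hp (k n) i t - H t\<bar> \<le> \<epsilon> \<and> \<bar>Hm (k n) i t - H t\<bar> \<le> \<epsilon>)"
      using ev_lim[OF h(1)] ev_inv[OF h(1), of "m 1"]
    proof eventually_elim
      case (elim n)
      show ?case
      proof (intro allI ballI)
        fix i t assume t: "t \<in> {0..1::real}"
        show "\<bar>Hp (k n) i t - H t\<bar> \<le> \<epsilon> \<and> \<bar>Hm (k n) i t - H t\<bar> \<le> \<epsilon>"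
          using close(1)[OF t, of "k n" i] close(2)[OF t, of "k n" i] bspec[OF elim(1) t] elim(2) by linarith
      qed
    qed
    \<comment> \<open>The budget in units of \<epsilon>/8: two for replacing \<open>F\<close> by
      \<open>H\<close> at the end points, two for the oscillation of \<open>m\<close> and one for
      \<open>m 1 / N\<close>.\<close>
    obtain d where d: "d > 0"
      "\<And>x y. x \<in> {0..1} \<Longrightarrow> y \<in> {0..1} \<Longrightarrow> dist x y < d \<Longrightarrow> dist (m x) (m y) < \<epsilon> / 8"
      using m_uc[unfolded uniformly_continuous_on_def, rule_format, OF h(2)] by blast
    show "\<forall>\<^sub>F n in sequentially. (\<forall>a b. 0 \<le> a \<longrightarrow> a \<le> b \<longrightarrow> b \<le> 1 \<longrightarrow>
          H b - H a \<le> integral {a..b} (hp (k n)) + \<epsilon> \<and> integral {a..b} (hm (k n)) \<le> H b - H a + \<epsilon>)"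
      using ev_lim[OF h(2)] ev_inv[OF h(2), of "m 1"] ev_inv[OF d(1), of 1]
    proof eventually_elim
      case (elim n)
      have osc: "\<forall>x\<in>{0..1}. \<forall>y\<in>{0..1}. \<bar>x - y\<bar> \<le> 1 / real (Suc (k n)) \<longrightarrow> \<bar>m x - m y\<bar> \<le> \<epsilon> / 8"
      proof (intro ballI impI)
        fix x y :: real
        assume xy: "x \<in> {0..1}" "y \<in> {0..1}" "\<bar>x - y\<bar> \<le> 1 / real (Suc (k n))"
        then have "dist x y < d" unfolding dist_real_def using elim(3) by linarith
        from d(2)[OF xy(1,2) this] show "\<bar>m x - m y\<bar> \<le> \<epsilon> / 8" by (simp add: dist_real_def)
      qed
      show ?case
      proof (intro allI impI)
        fix a b :: real assume ab: "0 \<le> a" "a \<le> b" "b \<le> 1"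
        have "\<bar>F (k n) a - H a\<bar> < \<epsilon> / 8" "\<bar>F (k n) b - H b\<bar> < \<epsilon> / 8"
          using elim(1) ab by auto
        then show "H b - H a \<le> integral {a..b} (hp (k n)) + \<epsilon> \<and> integral {a..b} (hm (k n)) \<le> H b - H a + \<epsilon>"
          using inc[OF osc ab] elim(2) unfolding abs_less_iff by linarith
      qed
    qed
  qed (rule H_in h_int h_eq)+
qed

section \<open>Discontinuity curves\<close>

lemma abs_le_supnorm:
  assumes "continuous_on {a..b} u" "t \<in> {a..b}"
  shows "\<bar>u t\<bar> \<le> supnorm a b u"
  unfolding supnorm_def
proof (rule cSUP_upper[OF assms(2)])
  have "compact ((\<lambda>t. \<bar>u t\<bar>) ` {a..b})"
    by (intro compact_continuous_image continuous_intros assms) simp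
  then show "bdd_above ((\<lambda>t. \<bar>u t\<bar>) ` {a..b})" by (intro bounded_imp_bdd_above compact_imp_bounded)
qed

lemma supnorm_le:
  assumes "a \<le> b" "\<And>t. t \<in> {a..b} \<Longrightarrow> \<bar>u t\<bar> \<le> c"
  shows "supnorm a b u \<le> c"
  unfolding supnorm_def by (rule cSUP_least) (use assms in auto)

lemma abs_supnorm_diff_le:
  assumes "a \<le> b" "continuous_on {a..b} u" "continuous_on {a..b} v"
    and le: "\<And>t. t \<in> {a..b} \<Longrightarrow> \<bar>u t - v t\<bar> \<le> c"
  shows "\<bar>supnorm a b u - supnorm a b v\<bar> \<le> c"
proof -
  have "supnorm a b u \<le> supnorm a b v + c"
  proof (rule supnorm_le[OF assms(1)])
    fix t assume t: "t \<in> {a..b}"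
    show "\<bar>u t\<bar> \<le> supnorm a b v + c" using le[OF t] abs_le_supnorm[OF assms(3) t] by linarith
  qed
  moreover have "supnorm a b v \<le> supnorm a b u + c"
  proof (rule supnorm_le[OF assms(1)])
    fix t assume t: "t \<in> {a..b}"
    show "\<bar>v t\<bar> \<le> supnorm a b u + c" using le[OF t] abs_le_supnorm[OF assms(2) t] by linarith
  qed
  ultimately show ?thesis by linarith
qed

lemma absolutely_integrable_restrict:
  fixes q :: "real \<Rightarrow> real"
  assumes q: "q absolutely_integrable_on {a..b}" and A: "A \<in> sets lebesgue"
  shows "(\<lambda>s. if s \<in> A then q s else 0) absolutely_integrable_on {a..b}"
proof -
  have "q absolutely_integrable_on ({a..b} \<inter> A)"
    by (rule set_integrable_subset[OF q]) (use A in auto)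
  then show ?thesis
    unfolding set_integrable_def
    by (rule back_subst[of "integrable lebesgue"]) (auto simp: indicator_def)
qed

text \<open>Being a primitive of \<open>g\<close>, \<gamma>1 is continuous, hence \<gamma> is
  differentiable at every point of the interval and not merely almost everywhere. This allows
  Rolle's theorem to be used on the contact set.\<close>

lemma W21_derivative:
  assumes "W21 a b \<gamma> g"
  obtains \<gamma>1 where "continuous_on {a..b} \<gamma>1"
    and "\<And>x y. a \<le> x \<Longrightarrow> x \<le> y \<Longrightarrow> y \<le> b \<Longrightarrow> \<gamma>1 y - \<gamma>1 x = integral {x..y} g"
    and "\<And>t. t \<in> {a..b} \<Longrightarrow> (\<gamma> has_real_derivative \<gamma>1 t) (at t within {a..b})"
proof -
  have g: "g absolutely_integrable_on {a..b}" using assms by (simp add: W21_def)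
  obtain \<gamma>1 where *: "\<forall>t\<in>{a..b}. \<gamma>1 t = \<gamma>1 a + (LINT s:{a..t}|lebesgue. g s) \<and>
      \<gamma> t = \<gamma> a + (LINT s:{a..t}|lebesgue. \<gamma>1 s)"
    using assms unfolding W21_def by (elim conjE exE)
  note \<gamma>1 = conjunct1[OF bspec[OF *]] and \<gamma> = conjunct2[OF bspec[OF *]]
  note gint = set_lebesgue_integral_eq_integral(1)[OF g]
  have 1: "\<gamma>1 t = \<gamma>1 a + integral {a..t} g" if "t \<in> {a..b}" for t
  proof -
    have "g absolutely_integrable_on {a..t}"
      by (rule absolutely_integrable_on_subinterval[OF g]) (use that in auto)
    then show ?thesis using \<gamma>1[OF that] by (simp add: set_lebesgue_integral_eq_integral)
  qed
  have "continuous_on {a..b} (\<lambda>t. \<gamma>1 a + integral {a..t} g)"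
    by (intro continuous_intros indefinite_integral_continuous_1 gint)
  then have cont: "continuous_on {a..b} \<gamma>1" by (rule continuous_on_eq) (simp add: 1[symmetric])
  have 2: "\<gamma> t = \<gamma> a + integral {a..t} \<gamma>1" if "t \<in> {a..b}" for t
  proof -
    have "\<gamma>1 absolutely_integrable_on {a..t}"
      by (rule absolutely_integrable_continuous_real, rule continuous_on_subset[OF cont]) (use that in auto)
    then show ?thesis using \<gamma>[OF that] by (simp add: set_lebesgue_integral_eq_integral)
  qed
  show ?thesis
  proof (rule that[OF cont])
    fix x y assume xy: "a \<le> x" "x \<le> y" "y \<le> b"
    have "g integrable_on {a..y}" by (rule integrable_on_subinterval[OF gint]) (use xy in auto)
    then have "integral {a..x} g + integral {x..y} g = integral {a..y} g"
      by (rule Henstock_Kurzweil_Integration.integral_combine[OF xy(1,2)])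
    then show "\<gamma>1 y - \<gamma>1 x = integral {x..y} g" using 1[of x] 1[of y] xy by simp
  next
    fix t assume t: "t \<in> {a..b}"
    have "((\<lambda>t. \<gamma> a + integral {a..t} \<gamma>1) has_real_derivative 0 + \<gamma>1 t) (at t within {a..b})"
      by (rule DERIV_add[OF DERIV_const integral_has_real_derivative[OF cont t]])
    then have "(\<gamma> has_real_derivative 0 + \<gamma>1 t) (at t within {a..b})"
      by (rule has_field_derivative_transform_within[OF _ zero_less_one t]) (rule 2[symmetric])
    then show "(\<gamma> has_real_derivative \<gamma>1 t) (at t within {a..b})" by simp
  qed
qed

lemma W21_continuous:
  assumes "W21 a b \<gamma> g"
  shows "continuous_on {a..b} \<gamma>"
proof (rule W21_derivative[OF assms])
  fix \<gamma>1 assume "\<And>t. t \<in> {a..b} \<Longrightarrow> (\<gamma> has_real_derivative \<gamma>1 t) (at t within {a..b})"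
  from DERIV_continuous[OF this] show ?thesis by (simp add: continuous_on_eq_continuous_within)
qed

text \<open>A level set of positive measure is an atom of the image of Lebesgue measure under
  \<open>c\<close>, and a finite measure has only countably many atoms.\<close>

lemma countable_fat_levels:
  assumes c: "continuous_on {a..b} (c :: real \<Rightarrow> real)"
  shows "countable {\<eta>. \<not> negligible {s\<in>{a..b}. c s = \<eta>}}"
proof -
  let ?L = "lebesgue_on {a..b}"
  have c': "c \<in> borel_measurable ?L"
    by (rule continuous_imp_measurable_on_sets_lebesgue[OF c]) simp
  interpret L: finite_measure ?L by (rule finite_measure_lebesgue_on) simp
  interpret N: finite_measure "distr ?L borel c" by (rule L.finite_measure_distr[OF c'])
  have "{\<eta>. \<not> negligible {s\<in>{a..b}. c s = \<eta>}} \<subseteq> {\<eta>. measure (distr ?L borel c) {\<eta>} \<noteq> 0}"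
  proof safe
    fix \<eta> assume neg: "\<not> negligible {s\<in>{a..b}. c s = \<eta>}" and 0: "measure (distr ?L borel c) {\<eta>} = 0"
    have eq: "c -` {\<eta>} \<inter> {a..b} = {s\<in>{a..b}. c s = \<eta>}" by auto
    have "emeasure (distr ?L borel c) {\<eta>} = 0" using 0 by (simp add: N.emeasure_eq_measure)
    then have "emeasure ?L {s\<in>{a..b}. c s = \<eta>} = 0"
      by (subst (asm) emeasure_distr[OF c']) (simp_all add: eq)
    moreover have "{s\<in>{a..b}. c s = \<eta>} \<in> sets ?L"
      using measurable_sets[OF c', of "{\<eta>}"] by (simp add: eq)
    ultimately have "emeasure lebesgue {s\<in>{a..b}. c s = \<eta>} = 0" "{s\<in>{a..b}. c s = \<eta>} \<in> sets lebesgue"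
      by (auto simp: emeasure_restrict_space sets_restrict_space_iff)
    then show False using neg by (auto simp: negligible_iff_null_sets)
  qed
  then show ?thesis using N.countable_support countable_subset by blast
qed

text \<open>A shift is bad for curve k exactly when it is a non-null level of
  \<open>\<gamma> k - u\<close>. Countably many curves exclude only countably many shifts, fewer
  than any open interval contains.\<close>

lemma shift_avoids_curves:
  fixes \<gamma> :: "nat \<Rightarrow> real \<Rightarrow> real"
  assumes u: "continuous_on {0..1} u" and \<gamma>: "\<And>k. continuous_on {a k..b k} (\<gamma> k)"
    and ab: "\<And>k. {a k..b k} \<subseteq> {0..1}" and c: "0 < c"
  shows "\<exists>\<eta>\<in>{0<..<c}. AE s in lebesgue. \<forall>k. s \<in> {a k..b k} \<longrightarrow> u s + \<eta> \<noteq> \<gamma> k s"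
proof -
  let ?bad = "\<Union>k. {\<eta>. \<not> negligible {s\<in>{a k..b k}. \<gamma> k s - u s = \<eta>}}"
  have "countable ?bad"
    by (rule countable_UN[OF countableI_type]) (rule countable_fat_levels[OF continuous_on_diff[OF \<gamma> continuous_on_subset[OF u ab]]])
  moreover have "uncountable {0<..<c}" using c by (simp add: uncountable_open_interval)
  ultimately obtain \<eta> where \<eta>: "\<eta> \<in> {0<..<c}" "\<eta> \<notin> ?bad"
    using countable_subset[of "{0<..<c}" ?bad] by blast
  have "AE s in lebesgue. s \<in> {a k..b k} \<longrightarrow> u s + \<eta> \<noteq> \<gamma> k s" for k
  proof -
    have "negligible {s\<in>{a k..b k}. \<gamma> k s - u s = \<eta>}" using \<eta>(2) by blast
    moreover have "{s\<in>{a k..b k}. \<gamma> k s - u s = \<eta>} = {s. \<not> (s \<in> {a k..b k} \<longrightarrow> u s + \<eta> \<noteq> \<gamma> k s)}"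
      by auto
    ultimately show ?thesis by (simp only: negligible_iff_AE)
  qed
  then have "AE s in lebesgue. \<forall>k. s \<in> {a k..b k} \<longrightarrow> u s + \<eta> \<noteq> \<gamma> k s"
    unfolding AE_all_countable by blast
  then show ?thesis using \<eta>(1) by blast
qed

text \<open>The hypotheses \<open>low\<close> and \<open>up\<close> are what the passage to the
  limit retains of the equation: eventual bounds on the densities bound the increments of
  \<open>H\<close>. On the contact set the arguments of f are eventually within \<epsilon> of the
  curve, so admissibility supplies such bounds and separates u'' from \<gamma>'' by \<psi>. Then
  \<open>negligible_contact_set\<close> applies to the difference of u and \<gamma>.\<close>

lemma negligible_curve_contact:
  fixes f :: "real \<Rightarrow> real \<Rightarrow> real \<Rightarrow> real" and hp hm :: "nat \<Rightarrow> real \<Rightarrow> real"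
  assumes adm: "admissible f lam a b \<gamma>" and lam: "0 < lam" and H: "continuous_on {0..1} H"
    and u: "\<And>t. t \<in> {0..1} \<Longrightarrow> u t = (1 - t) * c + lam * green_op H t"
    and low: "\<And>P x y. 0 \<le> x \<Longrightarrow> x \<le> y \<Longrightarrow> y \<le> 1 \<Longrightarrow> P absolutely_integrable_on {x..y} \<Longrightarrow>
        (\<forall>\<^sub>F n in sequentially. AE s in lebesgue. s \<in> {x..y} \<longrightarrow> P s \<le> hm n s) \<Longrightarrow>
        integral {x..y} P \<le> H y - H x"
    and up: "\<And>Q x y. 0 \<le> x \<Longrightarrow> x \<le> y \<Longrightarrow> y \<le> 1 \<Longrightarrow> Q absolutely_integrable_on {x..y} \<Longrightarrow>
        (\<forall>\<^sub>F n in sequentially. AE s in lebesgue. s \<in> {x..y} \<longrightarrow> hp n s \<le> Q s) \<Longrightarrow>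
        H y - H x \<le> integral {x..y} Q"
    and hm0: "\<And>n. AE s in lebesgue. s \<in> {0..1} \<longrightarrow> 0 \<le> hm n s"
    and hpM: "\<And>n. AE s in lebesgue. s \<in> {0..1} \<longrightarrow> hp n s \<le> M s"
    and M: "M absolutely_integrable_on {0..1}"
    and near: "\<And>\<epsilon>. 0 < \<epsilon> \<Longrightarrow> \<forall>\<^sub>F n in sequentially. \<forall>s\<in>{0..1}.
        (\<exists>x z. hm n s = f s x z \<and> 0 \<le> x \<and> 0 \<le> z \<and> \<bar>x - u s\<bar> \<le> \<epsilon>) \<and>
        (\<exists>x z. hp n s = f s x z \<and> 0 \<le> x \<and> 0 \<le> z \<and> \<bar>x - u s\<bar> \<le> \<epsilon>)"
  shows "negligible {t\<in>{a..b}. u t = \<gamma> t}"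
proof -
  from adm obtain g \<epsilon> \<psi> where ab: "0 \<le> a" "a \<le> b" "b \<le> 1" and W: "W21 a b \<gamma> g" and \<epsilon>: "0 < \<epsilon>"
    and \<psi>: "\<psi> absolutely_integrable_on {a..b}" and \<psi>0: "AE t in lebesgue. t \<in> {a..b} \<longrightarrow> \<psi> t > 0"
    and alt: "(AE t in lebesgue. t \<in> {a..b} \<longrightarrow>
              (\<forall>y z. 0 \<le> y \<and> \<gamma> t - \<epsilon> \<le> y \<and> y \<le> \<gamma> t + \<epsilon> \<and> 0 \<le> z \<longrightarrow> - g t + \<psi> t < lam * f t y z))
           \<or> (AE t in lebesgue. t \<in> {a..b} \<longrightarrow>
              (\<forall>y z. 0 \<le> y \<and> \<gamma> t - \<epsilon> \<le> y \<and> y \<le> \<gamma> t + \<epsilon> \<and> 0 \<le> z \<longrightarrow> - g t - \<psi> t > lam * f t y z))"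
    unfolding admissible_def by (elim conjE exE) (rule that)
  have g: "g absolutely_integrable_on {a..b}" using W by (simp add: W21_def)
  obtain \<gamma>1 where \<gamma>1c: "continuous_on {a..b} \<gamma>1"
    and \<gamma>1i: "\<And>x y. a \<le> x \<Longrightarrow> x \<le> y \<Longrightarrow> y \<le> b \<Longrightarrow> \<gamma>1 y - \<gamma>1 x = integral {x..y} g"
    and \<gamma>1d: "\<And>t. t \<in> {a..b} \<Longrightarrow> (\<gamma> has_real_derivative \<gamma>1 t) (at t within {a..b})"
    by (fact W21_derivative[OF W])
  have sub: "{a..b} \<subseteq> {0..1}" using ab by auto
  define u1 where "u1 t = - c + lam * (integral {0..1} H - H t)" for t
  have u1c: "continuous_on {a..b} u1"
    unfolding u1_def by (intro continuous_intros continuous_on_subset[OF H sub])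
  have u1d: "(u has_real_derivative u1 t) (at t within {a..b})" if t: "t \<in> {a..b}" for t
  proof -
    have t1: "t \<in> {0..1}" using t sub by blast
    have "((\<lambda>t. (1 - t) * c + lam * green_op H t) has_real_derivative (0 - 1) * c + lam * (integral {0..1} H - H t))
        (at t within {0..1})"
      by (rule DERIV_add[OF DERIV_cmult_right[OF DERIV_diff[OF DERIV_const DERIV_ident]]
          DERIV_cmult[OF green_op_has_derivative[OF H t1]]])
    then have "(u has_real_derivative (0 - 1) * c + lam * (integral {0..1} H - H t)) (at t within {0..1})"
      by (rule has_field_derivative_transform_within[OF _ zero_less_one t1]) (simp add: u)
    then show ?thesis unfolding u1_def by (intro DERIV_subset[OF _ sub]) simp
  qed
  let ?A = "{t\<in>{a..b}. u t = \<gamma> t}"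
  have uc: "continuous_on {a..b} u" and \<gamma>c: "continuous_on {a..b} \<gamma>"
    using DERIV_continuous[OF u1d] DERIV_continuous[OF \<gamma>1d] by (auto simp: continuous_on_eq_continuous_within)
  have "closed ?A"
    using continuous_closed_preimage[OF continuous_on_diff[OF uc \<gamma>c], of "{0}"]
    by (rule back_subst[of closed]) auto
  \<comment> \<open>Measurability of the contact set keeps functions cut off to it
    integrable.\<close>
  then have A: "?A \<in> sets lebesgue" by (intro sets_completionI_sets) (simp add: borel_closed)
  have int: "q integrable_on {x..y}" if "q absolutely_integrable_on {a..b}" "a \<le> x" "y \<le> b" for q :: "real \<Rightarrow> real" and x y
    by (rule set_lebesgue_integral_eq_integral(1), rule absolutely_integrable_on_subinterval[OF that(1)])
       (use that in auto)
  from alt show ?thesis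
  proof
    assume 1: "AE t in lebesgue. t \<in> {a..b} \<longrightarrow>
              (\<forall>y z. 0 \<le> y \<and> \<gamma> t - \<epsilon> \<le> y \<and> y \<le> \<gamma> t + \<epsilon> \<and> 0 \<le> z \<longrightarrow> - g t + \<psi> t < lam * f t y z)"
    \<comment> \<open>On the contact set admissibility gives the lower bound, elsewhere
      nonnegativity of \<open>hm\<close>. The choice makes \<open>lam * P + g\<close> equal to
      \<psi> on the contact set.\<close>
    define P where "P s = (if s \<in> ?A then (\<psi> s - g s) / lam else 0)" for s
    have P: "P absolutely_integrable_on {a..b}"
      unfolding P_def by (intro absolutely_integrable_restrict A set_integrable_divide set_integral_diff(1) \<psi> g)
    have evP: "\<forall>\<^sub>F n in sequentially. AE s in lebesgue. s \<in> {a..b} \<longrightarrow> P s \<le> hm n s"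
      using near[OF \<epsilon>]
    proof eventually_elim
      case (elim n)
      show ?case using 1 hm0[of n]
      proof eventually_elim
        case (elim s)
        show ?case
        proof
          assume s: "s \<in> {a..b}"
          show "P s \<le> hm n s"
          proof (cases "s \<in> ?A")
            case True
            obtain x z where xz: "hm n s = f s x z" "0 \<le> x" "0 \<le> z" "\<bar>x - u s\<bar> \<le> \<epsilon>"
              using \<open>\<forall>s\<in>{0..1}. _ s\<close> s sub by blast
            have us: "u s = \<gamma> s" using True by simp
            have "- g s + \<psi> s < lam * f s x z"
            proof (rule mp[OF spec[OF spec[OF mp[OF elim(1) s]]]])
              show "0 \<le> x \<and> \<gamma> s - \<epsilon> \<le> x \<and> x \<le> \<gamma> s + \<epsilon> \<and> 0 \<le> z" using xz us by auto
            qed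
            then have "(\<psi> s - g s) / lam \<le> f s x z" using lam by (simp add: divide_le_eq mult.commute)
            then show ?thesis using True xz(1) by (simp add: P_def)
          next
            case False
            have "P s = 0" unfolding P_def using False by (rule if_not_P)
            then show ?thesis using elim(2) s sub by auto
          qed
        qed
      qed
    qed
    have "negligible {t\<in>{a..b}. u t - \<gamma> t = 0}"
    proof (rule negligible_contact_set[of a b "\<lambda>t. u t - \<gamma> t" "\<lambda>t. u1 t - \<gamma>1 t" "\<lambda>t. lam * P t + g t"])
      show "((\<lambda>t. u t - \<gamma> t) has_real_derivative u1 t - \<gamma>1 t) (at t within {a..b})" if "t \<in> {a..b}" for t
        by (intro DERIV_diff u1d \<gamma>1d that)
      show "continuous_on {a..b} (\<lambda>t. u1 t - \<gamma>1 t)" by (intro continuous_intros u1c \<gamma>1c)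
      show "(\<lambda>t. lam * P t + g t) integrable_on {a..b}"
        by (intro Henstock_Kurzweil_Integration.integrable_add integrable_on_mult_right int P g order_refl)
      show "AE t in lebesgue. t \<in> {a..b} \<longrightarrow> u t - \<gamma> t = 0 \<longrightarrow> 0 < lam * P t + g t"
        using \<psi>0 by eventually_elim (use lam in \<open>auto simp: P_def\<close>)
      fix x y assume xy: "a \<le> x" "x \<le> y" "y \<le> b"
      have "integral {x..y} P \<le> H y - H x"
      proof (rule low)
        show "P absolutely_integrable_on {x..y}"
          by (rule absolutely_integrable_on_subinterval[OF P]) (use xy in auto)
        show "\<forall>\<^sub>F n in sequentially. AE s in lebesgue. s \<in> {x..y} \<longrightarrow> P s \<le> hm n s"
          using evP
        proof eventually_elim
          case (elim n)
          then show ?case by eventually_elim (use xy in auto)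
        qed
      qed (use xy ab in auto)
      then have "lam * integral {x..y} P \<le> lam * (H y - H x)" using lam by simp
      moreover have "integral {x..y} (\<lambda>t. lam * P t + g t) = lam * integral {x..y} P + integral {x..y} g"
        using int[OF P xy(1,3)] int[OF g xy(1,3)]
        by (subst Henstock_Kurzweil_Integration.integral_add) (auto intro: integrable_on_mult_right)
      ultimately show "u1 y - \<gamma>1 y - (u1 x - \<gamma>1 x) \<le> - integral {x..y} (\<lambda>t. lam * P t + g t)"
        using \<gamma>1i[OF xy] by (simp add: u1_def algebra_simps)
    qed
    then show ?thesis by simp
  next
    assume 2: "AE t in lebesgue. t \<in> {a..b} \<longrightarrow>
              (\<forall>y z. 0 \<le> y \<and> \<gamma> t - \<epsilon> \<le> y \<and> y \<le> \<gamma> t + \<epsilon> \<and> 0 \<le> z \<longrightarrow> - g t - \<psi> t > lam * f t y z)"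
    \<comment> \<open>Off the contact set only the majorant \<open>M\<close> is available as an
      upper bound; on it \<open>- (lam * Q + g)\<close> equals \<psi>.\<close>
    define Q where "Q s = (if s \<in> ?A then (- 1) * (g s + \<psi> s) / lam else 0) + (if s \<in> - ?A then M s else 0)" for s
    have Mab: "M absolutely_integrable_on {a..b}"
      by (rule absolutely_integrable_on_subinterval[OF M sub])
    have Q: "Q absolutely_integrable_on {a..b}"
      unfolding Q_def
      by (intro set_integral_add(1) absolutely_integrable_restrict A set_integrable_divide
          set_integrable_mult_right \<psi> g Mab) (use A in \<open>simp only: Compl_in_sets_lebesgue\<close>)
    have evQ: "\<forall>\<^sub>F n in sequentially. AE s in lebesgue. s \<in> {a..b} \<longrightarrow> hp n s \<le> Q s"
      using near[OF \<epsilon>]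
    proof eventually_elim
      case (elim n)
      show ?case using 2 hpM[of n]
      proof eventually_elim
        case (elim s)
        show ?case
        proof
          assume s: "s \<in> {a..b}"
          show "hp n s \<le> Q s"
          proof (cases "s \<in> ?A")
            case True
            obtain x z where xz: "hp n s = f s x z" "0 \<le> x" "0 \<le> z" "\<bar>x - u s\<bar> \<le> \<epsilon>"
              using \<open>\<forall>s\<in>{0..1}. _ s\<close> s sub by blast
            have us: "u s = \<gamma> s" using True by simp
            have "- g s - \<psi> s > lam * f s x z"
            proof (rule mp[OF spec[OF spec[OF mp[OF elim(1) s]]]])
              show "0 \<le> x \<and> \<gamma> s - \<epsilon> \<le> x \<and> x \<le> \<gamma> s + \<epsilon> \<and> 0 \<le> z" using xz us by auto
            qed
            then have "f s x z \<le> (- g s - \<psi> s) / lam" using lam by (simp add: le_divide_eq mult.commute)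
            then show ?thesis using True xz(1) by (simp add: Q_def)
          next
            case False
            have "Q s = M s" unfolding Q_def using False by auto
            then show ?thesis using elim(2) s sub by auto
          qed
        qed
      qed
    qed
    \<comment> \<open>An upper bound on the density bounds u'' from below, so the function with
      negative second derivative on the contact set is now \<gamma> - u.\<close>
    have "negligible {t\<in>{a..b}. \<gamma> t - u t = 0}"
    proof (rule negligible_contact_set[of a b "\<lambda>t. \<gamma> t - u t" "\<lambda>t. \<gamma>1 t - u1 t" "\<lambda>t. - (lam * Q t + g t)"])
      show "((\<lambda>t. \<gamma> t - u t) has_real_derivative \<gamma>1 t - u1 t) (at t within {a..b})" if "t \<in> {a..b}" for t
        by (intro DERIV_diff u1d \<gamma>1d that)
      show "continuous_on {a..b} (\<lambda>t. \<gamma>1 t - u1 t)" by (intro continuous_intros u1c \<gamma>1c)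
      show "(\<lambda>t. - (lam * Q t + g t)) integrable_on {a..b}"
        by (intro integrable_neg Henstock_Kurzweil_Integration.integrable_add integrable_on_mult_right int Q g order_refl)
      show "AE t in lebesgue. t \<in> {a..b} \<longrightarrow> \<gamma> t - u t = 0 \<longrightarrow> 0 < - (lam * Q t + g t)"
        using \<psi>0 by eventually_elim (use lam in \<open>auto simp: Q_def\<close>)
      fix x y assume xy: "a \<le> x" "x \<le> y" "y \<le> b"
      have "H y - H x \<le> integral {x..y} Q"
      proof (rule up)
        show "Q absolutely_integrable_on {x..y}"
          by (rule absolutely_integrable_on_subinterval[OF Q]) (use xy in auto)
        show "\<forall>\<^sub>F n in sequentially. AE s in lebesgue. s \<in> {x..y} \<longrightarrow> hp n s \<le> Q s"
          using evQ
        proof eventually_elim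
          case (elim n)
          then show ?case by eventually_elim (use xy in auto)
        qed
      qed (use xy ab in auto)
      then have "lam * (H y - H x) \<le> lam * integral {x..y} Q" using lam by simp
      moreover have "integral {x..y} (\<lambda>t. lam * Q t + g t) = lam * integral {x..y} Q + integral {x..y} g"
        using int[OF Q xy(1,3)] int[OF g xy(1,3)]
        by (subst Henstock_Kurzweil_Integration.integral_add) (auto intro: integrable_on_mult_right)
      ultimately show "\<gamma>1 y - u1 y - (\<gamma>1 x - u1 x) \<le> - integral {x..y} (\<lambda>t. - (lam * Q t + g t))"
        using \<gamma>1i[OF xy] unfolding Henstock_Kurzweil_Integration.integral_neg by (simp add: u1_def algebra_simps)
    qed
    moreover have "{t\<in>{a..b}. \<gamma> t - u t = 0} = ?A" by auto
    ultimately show ?thesis by simp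
  qed
qed

section \<open>The eigenvalue problem\<close>

theorem theorem3p4:
  fixes r \<rho> :: real
    and \<sigma> \<omega> :: "real \<Rightarrow> real"
    and f :: "real \<Rightarrow> real \<Rightarrow> real \<Rightarrow> real"
    and M \<delta> :: "real \<Rightarrow> real"
    and a b :: "nat \<Rightarrow> real" and \<gamma> :: "nat \<Rightarrow> real \<Rightarrow> real"
    and lbar :: real
  assumes r: "0 \<le> r"
    and \<sigma>cont: "continuous_on {0..1} \<sigma>" and \<sigma>range: "\<sigma> ` {0..1} \<subseteq> {-r..1}"
    and \<omega>cont: "continuous_on {-r..0} \<omega>" and \<omega>nonneg: "\<forall>t\<in>{-r..0}. 0 \<le> \<omega> t"
    and fnonneg: "\<forall>t\<in>{0..1}. \<forall>u\<ge>0. \<forall>v\<ge>0. 0 \<le> f t u v"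
    and \<rho>: "0 < \<rho>"
    and H1: "\<And>u v. continuous_on {0..1} u \<Longrightarrow> (\<forall>t\<in>{0..1}. 0 \<le> u t)
               \<Longrightarrow> continuous_on {0..1} v \<Longrightarrow> (\<forall>t\<in>{0..1}. 0 \<le> v t)
               \<Longrightarrow> set_borel_measurable lebesgue {0..1} (\<lambda>t. f t (u t) (v t))"
    and H2M: "set_integrable lebesgue {0..1} M"
    and H2: "AE t in lebesgue. t \<in> {0..1} \<longrightarrow>
               (\<forall>u v. 0 \<le> u \<and> u \<le> \<rho> + supnorm (-r) 0 \<omega> \<and> 0 \<le> v \<and> v \<le> \<rho> + supnorm (-r) 0 \<omega>
                  \<longrightarrow> f t u v \<le> M t)"
    and H3\<delta>: "set_integrable lebesgue {1/4..3/4} \<delta>"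
    and H3: "AE t in lebesgue. t \<in> {1/4..3/4} \<longrightarrow>
               (\<forall>u v. 0 \<le> u \<and> u \<le> \<rho> + supnorm (-r) 0 \<omega> \<and> 0 \<le> v \<and> v \<le> \<rho> + supnorm (-r) 0 \<omega>
                  \<longrightarrow> \<delta> t \<le> f t u v)"
    and H3bar: "0 < (SUP t\<in>{1/4..3/4}. LINT s:{1/4..3/4}|lebesgue. kker t s * \<delta> s)"
    and H4cont: "AE t in lebesgue. t \<in> {0..1} \<longrightarrow>
                   continuous_on (({0..} - {\<gamma> n t | n. t \<in> {a n..b n}}) \<times> {0..})
                                 (\<lambda>(x, z). f t x z)"
    and H4bar: "lbar > \<rho> / (SUP t\<in>{1/4..3/4}. LINT s:{1/4..3/4}|lebesgue. kker t s * \<delta> s)"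
    and H4adm: "\<And>n lam. 0 < lam \<Longrightarrow> lam \<le> lbar \<Longrightarrow> admissible f lam (a n) (b n) (\<gamma> n)"
  shows "\<exists>lam\<rho> u\<rho>. 0 < lam\<rho> \<and> lam\<rho> < lbar \<and> u\<rho> \<in> bdKy r (yfun \<omega>) \<rho> \<and>
           set_integrable lebesgue {0..1} (\<lambda>s. f s (u\<rho> s) (u\<rho> (\<sigma> s))) \<and>
           (\<forall>t\<in>{-r..1}. u\<rho> t = yfun \<omega> t +
               lam\<rho> * (LINT s:{0..1}|lebesgue. kker t s * f s (u\<rho> s) (u\<rho> (\<sigma> s))))"
proof -

  \<comment> \<open>Bounds and regularity of the data\<close>
  define S where "S = supnorm (-r) 0 \<omega>"
  define R where "R = \<rho> + S"
  define y where "y = yfun \<omega>"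
  define \<delta>bar where "\<delta>bar = (SUP t\<in>{1/4..3/4}. LINT s:{1/4..3/4}|lebesgue. kker t s * \<delta> s)"
  have \<delta>bar: "0 < \<delta>bar" using H3bar by (simp add: \<delta>bar_def)
  have lbar: "\<rho> / \<delta>bar < lbar" using H4bar by (simp add: \<delta>bar_def)
  have lbar0: "0 < lbar" using lbar \<rho> \<delta>bar by (meson divide_pos_pos less_trans)
  have \<omega>S: "\<omega> t \<le> S" if "t \<in> {-r..0}" for t
    using abs_le_supnorm[OF \<omega>cont that] by (simp add: S_def)
  have w0: "0 \<le> \<omega> 0" "\<omega> 0 \<le> S" using \<omega>S[of 0] bspec[OF \<omega>nonneg, of 0] r by auto
  then have S0: "0 \<le> S" by linarith
  have R0: "0 < R" using S0 \<rho> by (simp add: R_def)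
  have y0: "0 \<le> y t" and yS: "y t \<le> S" if "t \<in> {-r..1}" for t
  proof -
    have "(1 - t) * \<omega> 0 \<le> 1 * \<omega> 0" if "0 < t" using w0 that by (intro mult_right_mono) auto
    then show "0 \<le> y t" "y t \<le> S"
      using that \<omega>S[of t] \<omega>nonneg w0 by (auto simp: y_def yfun_def)
  qed
  have ycont: "continuous_on {-r..1} y"
  proof -
    have "{-r..1} = {-r..0} \<union> {0..1}" using r by auto
    moreover have "continuous_on ({-r..0} \<union> {0..1}) (\<lambda>t. if t \<le> 0 then \<omega> t else (1 - t) * \<omega> 0)"
      by (rule continuous_on_If) (auto intro!: continuous_intros \<omega>cont)
    ultimately show ?thesis by (simp add: y_def yfun_def[abs_def])
  qed
  have I_sub: "{a k..b k} \<subseteq> {0..1}" and \<gamma>cont: "continuous_on {a k..b k} (\<gamma> k)" for k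
  proof -
    have adm: "admissible f lbar (a k) (b k) (\<gamma> k)" using H4adm[OF lbar0] by simp
    then show "{a k..b k} \<subseteq> {0..1}" by (auto simp: admissible_def)
    from adm obtain g where W: "W21 (a k) (b k) (\<gamma> k) g" unfolding admissible_def by blast
    then show "continuous_on {a k..b k} (\<gamma> k)" by (rule W21_continuous)
  qed

  \<comment> \<open>The superposition operator on functions with values in [0,R]\<close>
  define M0 where "M0 s = \<bar>M s\<bar>" for s
  have M0: "M0 absolutely_integrable_on {0..1}"
    unfolding M0_def using absolutely_integrable_norm[OF H2M] by (simp add: o_def)
  define m where "m = (\<lambda>t. integral {0..t} M0)"
  have mcont: "continuous_on {0..1} m"
    unfolding m_def by (rule indefinite_integral_continuous_1[OF set_lebesgue_integral_eq_integral(1)[OF M0]])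
  have inc_cont: "continuous_on {0..1} H" if "H \<in> increments_below m" for H
    by (rule increments_below_continuous[OF mcont that])

  define nemytskii where "nemytskii w s = f s (w s) (w (\<sigma> s))" for w s
  \<comment> \<open>The range [0,R] is exactly where (H2) and (H3) provide bounds, both for w and
    for its composition with \<sigma>.\<close>
  define adm where "adm w \<longleftrightarrow> continuous_on {-r..1} w \<and> (\<forall>t\<in>{-r..1}. 0 \<le> w t \<and> w t \<le> R)" for w
  have \<sigma>in: "\<sigma> s \<in> {-r..1}" if "s \<in> {0..1}" for s using \<sigma>range that by blast
  have in_r: "s \<in> {-r..1}" if "s \<in> {0..1}" for s using that r by auto
  have nem_bounds: "AE s in lebesgue. s \<in> {0..1} \<longrightarrow> 0 \<le> nemytskii w s \<and> nemytskii w s \<le> M0 s"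
    and nem_low: "AE s in lebesgue. s \<in> {1/4..3/4} \<longrightarrow> \<delta> s \<le> nemytskii w s"
    and nem_int: "nemytskii w absolutely_integrable_on {0..1}" if w: "adm w" for w
  proof -
    have wR: "0 \<le> w s \<and> w s \<le> R \<and> 0 \<le> w (\<sigma> s) \<and> w (\<sigma> s) \<le> R" if "s \<in> {0..1}" for s
      using w \<sigma>in[OF that] in_r[OF that] by (simp add: adm_def)
    show bd: "AE s in lebesgue. s \<in> {0..1} \<longrightarrow> 0 \<le> nemytskii w s \<and> nemytskii w s \<le> M0 s"
      using H2
    proof eventually_elim
      case (elim s)
      show ?case
      proof
        assume s: "s \<in> {0..1}"
        have "f s (w s) (w (\<sigma> s)) \<le> M s" using elim s wR[OF s] by (simp add: R_def S_def)
        moreover have "0 \<le> f s (w s) (w (\<sigma> s))" using fnonneg s wR[OF s] by blast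
        ultimately show "0 \<le> nemytskii w s \<and> nemytskii w s \<le> M0 s" by (simp add: nemytskii_def M0_def)
      qed
    qed
    show "AE s in lebesgue. s \<in> {1/4..3/4} \<longrightarrow> \<delta> s \<le> nemytskii w s"
      using H3
    proof eventually_elim
      case (elim s)
      show ?case
      proof
        assume s: "s \<in> {1/4..3/4}"
        then have "s \<in> {0..1}" by auto
        then show "\<delta> s \<le> nemytskii w s" using elim s wR[of s] by (simp add: R_def S_def nemytskii_def)
      qed
    qed
    have "set_borel_measurable lebesgue {0..1} (\<lambda>t. f t (w t) (w (\<sigma> t)))"
    proof (rule H1)
      show "continuous_on {0..1} w" "continuous_on {0..1} (\<lambda>t. w (\<sigma> t))"
        using w \<sigma>range r unfolding adm_def
        by (auto intro: continuous_on_subset continuous_on_compose2[OF _ \<sigma>cont])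
    qed (use wR in auto)
    then have "set_borel_measurable lebesgue {0..1} (nemytskii w)" by (simp add: nemytskii_def[abs_def])
    then show "nemytskii w absolutely_integrable_on {0..1}"
      by (rule set_integrable_bound[OF M0]) (rule eventually_mono[OF bd], simp add: M0_def)
  qed

  \<comment> \<open>The normalised Green operator\<close>
  define nrm where "nrm H = supnorm 0 1 (green_op H)" for H
  \<comment> \<open>Dividing by the norm fixes the size \<rho> in advance and leaves \<lambda> to be
    read off at the end. If the norm is 0, division by zero yields 0 and \<open>base H\<close> is
    just \<open>y\<close>; the resulting discontinuity in H is harmless for Kuhn's lemma.\<close>
  define base where "base H t = y t + (if t \<le> 0 then 0 else \<rho> * green_op H t / nrm H)" for H t
  have green_cont: "continuous_on {0..1} (green_op H)" if "H \<in> increments_below m" for H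
    using DERIV_continuous[OF green_op_has_derivative[OF inc_cont[OF that]]]
    by (simp add: continuous_on_eq_continuous_within)
  have green0: "0 \<le> green_op H t" if "H \<in> increments_below m" "t \<in> {0..1}" for H t
    using increments_belowD(2)[OF that(1)]
    by (intro green_op_nonneg inc_cont that) (auto simp: mono_on_def)
  have green_nrm: "green_op H t \<le> nrm H" if "H \<in> increments_below m" "t \<in> {0..1}" for H t
    using abs_le_supnorm[OF green_cont[OF that(1)] that(2)] by (simp add: nrm_def)
  have quot: "0 \<le> \<rho> * green_op H t / nrm H \<and> \<rho> * green_op H t / nrm H \<le> \<rho>"
    if "H \<in> increments_below m" "t \<in> {0..1}" for H t
  proof -
    have "0 \<le> nrm H" using green0[OF that] green_nrm[OF that] by linarith
    then have "green_op H t / nrm H \<le> 1" "0 \<le> green_op H t / nrm H"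
      using green0[OF that] green_nrm[OF that] by (auto simp: divide_le_eq_1)
    then show ?thesis using \<rho> by (auto simp: mult_left_le simp flip: times_divide_eq_right)
  qed
  have base_adm: "adm (base H)" if H: "H \<in> increments_below m" for H
    unfolding adm_def
  proof (intro conjI ballI)
    have "{-r..1} = {-r..0} \<union> {0..1}" using r by auto
    moreover have "continuous_on ({-r..0} \<union> {0..1}) (\<lambda>t. if t \<le> 0 then 0 else \<rho> * green_op H t / nrm H)"
      by (rule continuous_on_If)
         (auto simp: green_op_def[of H 0] divide_inverse intro!: continuous_intros green_cont[OF H])
    ultimately show "continuous_on {-r..1} (base H)"
      unfolding base_def using ycont by (intro continuous_on_add) auto
    fix t assume t: "t \<in> {-r..1}"
    show "0 \<le> base H t" "base H t \<le> R"
      using y0[OF t] yS[OF t] quot[OF H, of t] t \<rho> by (auto simp: base_def R_def)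
  qed

  \<comment> \<open>Perturbations avoiding the discontinuity curves\<close>
  have pert_ex: "\<exists>w. adm w \<and> (\<forall>t\<in>{-r..1}. \<bar>w t - base H t\<bar> \<le> R / real (Suc n))
      \<and> (AE s in lebesgue. \<forall>k. s \<in> {a k..b k} \<longrightarrow> w s \<noteq> \<gamma> k s)" if H: "H \<in> increments_below m" for H n
  proof -
    \<comment> \<open>Contracting by 1 - \<kappa> makes room for an upward shift smaller than
      \<kappa>R: the perturbed function stays in [0,R] and moves by at most \<kappa>R.\<close>
    define \<kappa> where "\<kappa> = 1 / real (Suc n)"
    have \<kappa>: "0 < \<kappa>" "\<kappa> \<le> 1" by (auto simp: \<kappa>_def)
    have bc: "continuous_on {-r..1} (base H)" and bR: "\<And>t. t \<in> {-r..1} \<Longrightarrow> 0 \<le> base H t \<and> base H t \<le> R"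
      using base_adm[OF H] by (auto simp: adm_def)
    have "continuous_on {0..1} (base H)" by (rule continuous_on_subset[OF bc]) (use r in auto)
    then have "continuous_on {0..1} (\<lambda>s. (1 - \<kappa>) * base H s)" by (intro continuous_intros)
    then have "\<exists>\<eta>\<in>{0<..<\<kappa> * R}. AE s in lebesgue. \<forall>k. s \<in> {a k..b k} \<longrightarrow> (1 - \<kappa>) * base H s + \<eta> \<noteq> \<gamma> k s"
      by (rule shift_avoids_curves[OF _ \<gamma>cont I_sub]) (use \<kappa> R0 in simp)
    then obtain \<eta> where \<eta>: "0 < \<eta>" "\<eta> < \<kappa> * R"
      and av: "AE s in lebesgue. \<forall>k. s \<in> {a k..b k} \<longrightarrow> (1 - \<kappa>) * base H s + \<eta> \<noteq> \<gamma> k s"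
      unfolding greaterThanLessThan_iff Bex_def by blast
    show ?thesis
    proof (intro exI[of _ "\<lambda>s. (1 - \<kappa>) * base H s + \<eta>"] conjI av ballI)
      show "adm (\<lambda>s. (1 - \<kappa>) * base H s + \<eta>)"
        unfolding adm_def
      proof (intro conjI ballI)
        fix t assume t: "t \<in> {-r..1}"
        show "0 \<le> (1 - \<kappa>) * base H t + \<eta>" using bR[OF t] \<kappa> \<eta> by simp
        have "(1 - \<kappa>) * base H t \<le> (1 - \<kappa>) * R" using bR[OF t] \<kappa> by (intro mult_left_mono) auto
        then show "(1 - \<kappa>) * base H t + \<eta> \<le> R" using \<eta> by (simp add: left_diff_distrib)
      qed (intro continuous_intros bc)
      fix t assume t: "t \<in> {-r..1}"
      have "\<kappa> * base H t \<le> \<kappa> * R" "0 \<le> \<kappa> * base H t" using bR[OF t] \<kappa> by auto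
      then have "\<bar>\<eta> - \<kappa> * base H t\<bar> \<le> \<kappa> * R" using \<eta> by linarith
      then show "\<bar>(1 - \<kappa>) * base H t + \<eta> - base H t\<bar> \<le> R / real (Suc n)"
        by (simp add: \<kappa>_def algebra_simps)
    qed
  qed
  define U where "U n H = (SOME w. adm w \<and> (\<forall>t\<in>{-r..1}. \<bar>w t - base H t\<bar> \<le> R / real (Suc n))
      \<and> (AE s in lebesgue. \<forall>k. s \<in> {a k..b k} \<longrightarrow> w s \<noteq> \<gamma> k s))" for n H
  note U = someI_ex[OF pert_ex, folded U_def]
  note U_adm = conjunct1[OF U] and U_av = conjunct2[OF conjunct2[OF U]]
  have U_base: "\<bar>U n H t - base H t\<bar> \<le> R / real (Suc n)" if "H \<in> increments_below m" "t \<in> {-r..1}" for n H t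
    using conjunct1[OF conjunct2[OF U[OF that(1)]]] that(2) by blast

  \<comment> \<open>The limit primitive and the approximating densities\<close>
  obtain H k Hp Hm hp hm where H: "H \<in> increments_below m" and k: "strict_mono (k :: nat \<Rightarrow> nat)"
    and Hp: "\<And>n i. Hp n i \<in> increments_below m" and Hm: "\<And>n i. Hm n i \<in> increments_below m"
    and hp_int: "\<And>n. hp n absolutely_integrable_on {0..1}" and hm_int: "\<And>n. hm n absolutely_integrable_on {0..1}"
    and hp: "\<And>n s. \<exists>i::nat. hp n s = nemytskii (U (k n) (Hp n i)) s"
    and hm: "\<And>n s. \<exists>i::nat. hm n s = nemytskii (U (k n) (Hm n i)) s"
    and close: "\<And>\<epsilon>. 0 < \<epsilon> \<Longrightarrow> \<forall>\<^sub>F n in sequentially.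
        (\<forall>i. \<forall>t\<in>{0..1}. \<bar>Hp n i t - H t\<bar> \<le> \<epsilon> \<and> \<bar>Hm n i t - H t\<bar> \<le> \<epsilon>)"
    and incs: "\<And>\<epsilon>. 0 < \<epsilon> \<Longrightarrow> \<forall>\<^sub>F n in sequentially.
        (\<forall>a b. 0 \<le> a \<longrightarrow> a \<le> b \<longrightarrow> b \<le> 1 \<longrightarrow>
          H b - H a \<le> integral {a..b} (hp n) + \<epsilon> \<and> integral {a..b} (hm n) \<le> H b - H a + \<epsilon>)"
  proof (rule limit_solution[OF M0 _ m_def, of "\<lambda>n H. nemytskii (U n H)"], goal_cases)
    case (1 s) show ?case by (simp add: M0_def)
  next
    case (2 n H) show ?case by (rule nem_int[OF U_adm[OF 2(2)]])
  next
    case (3 n H) show ?case by (rule nem_bounds[OF U_adm[OF 3(2)]])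
  next
    case (4 H k Hp Hm hp hm)
    show thesis by (rule that[of H k Hp Hm hp hm]) (fact 4)+
  qed

  \<comment> \<open>The index i depends on s, so the exceptional null sets of all the countably many
    i are discarded at once.\<close>
  have AE_hp: "AE s in lebesgue. Q s (hp n s)"
    if "\<And>i. AE s in lebesgue. Q s (nemytskii (U (k n) (Hp n i)) s)" for Q n
  proof -
    have "AE s in lebesgue. \<forall>i. Q s (nemytskii (U (k n) (Hp n i)) s)"
      unfolding AE_all_countable using that by blast
    then show ?thesis
    proof eventually_elim
      case (elim s)
      obtain i where "hp n s = nemytskii (U (k n) (Hp n i)) s" using hp by blast
      then show ?case using elim by simp
    qed
  qed
  have AE_hm: "AE s in lebesgue. Q s (hm n s)"
    if "\<And>i. AE s in lebesgue. Q s (nemytskii (U (k n) (Hm n i)) s)" for Q n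
  proof -
    have "AE s in lebesgue. \<forall>i. Q s (nemytskii (U (k n) (Hm n i)) s)"
      unfolding AE_all_countable using that by blast
    then show ?thesis
    proof eventually_elim
      case (elim s)
      obtain i where "hm n s = nemytskii (U (k n) (Hm n i)) s" using hm by blast
      then show ?case using elim by simp
    qed
  qed
  have hp_bounds: "AE s in lebesgue. s \<in> {0..1} \<longrightarrow> 0 \<le> hp n s \<and> hp n s \<le> M0 s" for n
    by (rule AE_hp[where Q = "\<lambda>s v. s \<in> {0..1} \<longrightarrow> 0 \<le> v \<and> v \<le> M0 s"]) (rule nem_bounds[OF U_adm[OF Hp]])
  have hm_bounds: "AE s in lebesgue. s \<in> {0..1} \<longrightarrow> 0 \<le> hm n s \<and> hm n s \<le> M0 s" for n
    by (rule AE_hm[where Q = "\<lambda>s v. s \<in> {0..1} \<longrightarrow> 0 \<le> v \<and> v \<le> M0 s"]) (rule nem_bounds[OF U_adm[OF Hm]])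
  have hm_low: "AE s in lebesgue. s \<in> {1/4..3/4} \<longrightarrow> \<delta> s \<le> hm n s" for n
    by (rule AE_hm[where Q = "\<lambda>s v. s \<in> {1/4..3/4} \<longrightarrow> \<delta> s \<le> v"]) (rule nem_low[OF U_adm[OF Hm]])

  \<comment> \<open>Transfer of bounds from the densities to the limit\<close>
  have low: "integral {x..z} P \<le> H z - H x"
    if xz: "0 \<le> x" "x \<le> z" "z \<le> 1" and P: "P absolutely_integrable_on {x..z}"
      and ev: "\<forall>\<^sub>F n in sequentially. AE s in lebesgue. s \<in> {x..z} \<longrightarrow> P s \<le> hm n s" for P x z
  proof (rule field_le_epsilon)
    fix e :: real assume e: "0 < e"
    have "\<forall>\<^sub>F n in sequentially. integral {x..z} P \<le> H z - H x + e"
      using ev incs[OF e]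
    proof eventually_elim
      case (elim n)
      have "hm n absolutely_integrable_on {x..z}"
        by (rule absolutely_integrable_on_subinterval[OF hm_int]) (use xz in auto)
      then have "integral {x..z} P \<le> integral {x..z} (hm n)"
        by (rule integral_mono_AE_interval[OF P _ elim(1)])
      then show ?case using elim(2) xz by force
    qed
    then show "integral {x..z} P \<le> H z - H x + e" by simp
  qed
  have up: "H z - H x \<le> integral {x..z} P"
    if xz: "0 \<le> x" "x \<le> z" "z \<le> 1" and P: "P absolutely_integrable_on {x..z}"
      and ev: "\<forall>\<^sub>F n in sequentially. AE s in lebesgue. s \<in> {x..z} \<longrightarrow> hp n s \<le> P s" for P x z
  proof (rule field_le_epsilon)
    fix e :: real assume e: "0 < e"
    have "\<forall>\<^sub>F n in sequentially. H z - H x \<le> integral {x..z} P + e"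
      using ev incs[OF e]
    proof eventually_elim
      case (elim n)
      have "hp n absolutely_integrable_on {x..z}"
        by (rule absolutely_integrable_on_subinterval[OF hp_int]) (use xz in auto)
      then have "integral {x..z} (hp n) \<le> integral {x..z} P"
        by (rule integral_mono_AE_interval[OF _ P elim(1)])
      then show ?case using elim(2) xz by force
    qed
    then show "H z - H x \<le> integral {x..z} P + e" by simp
  qed

  \<comment> \<open>Lower bound for the norm and the parameter \<lambda>\<close>
  let ?B = "{1/4..3/4::real}"
  \<comment> \<open>\<delta> may be negative. Its positive part, extended by zero, is still almost
    everywhere below \<open>hm\<close>, and by \<open>G \<ge> 0\<close> the replacement only
    increases the kernel integral.\<close>
  define \<delta>p where "\<delta>p s = (\<delta> s + \<bar>\<delta> s\<bar>) / 2" for s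
  define \<delta>0 where "\<delta>0 s = (if s \<in> ?B then \<delta>p s else 0)" for s
  have \<delta>p: "\<delta>p absolutely_integrable_on ?B"
    unfolding \<delta>p_def using absolutely_integrable_norm[OF H3\<delta>]
    by (intro set_integrable_divide set_integral_add(1) H3\<delta>) (simp add: o_def)
  have \<delta>0: "\<delta>0 absolutely_integrable_on {0..1}"
    using \<delta>p unfolding set_integrable_def \<delta>0_def
    by (rule back_subst[of "integrable lebesgue"]) (auto simp: indicator_def)
  define E where "E t = integral {0..t} \<delta>0" for t
  have E_cont: "continuous_on {0..1} E"
    unfolding E_def by (rule indefinite_integral_continuous_1[OF set_lebesgue_integral_eq_integral(1)[OF \<delta>0]])
  have green_ge: "(LINT s:?B|lebesgue. kker t s * \<delta> s) \<le> green_op H t" if t: "t \<in> ?B" for t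
  proof -
    have t01: "t \<in> {0..1}" using t by auto
    have i1: "(\<lambda>s. G t s * \<delta> s) absolutely_integrable_on ?B" "(\<lambda>s. G t s * \<delta>p s) absolutely_integrable_on ?B"
      by (intro absolutely_integrable_continuous_product continuous_on_G H3\<delta> \<delta>p)+
    have "(LINT s:?B|lebesgue. kker t s * \<delta> s) = (LINT s:?B|lebesgue. G t s * \<delta> s)"
      using t by (simp add: kker_def)
    also have "\<dots> = integral ?B (\<lambda>s. G t s * \<delta> s)"
      using i1(1) by (rule set_lebesgue_integral_eq_integral)
    also have "\<dots> \<le> integral ?B (\<lambda>s. G t s * \<delta>p s)"
    proof (rule integral_le[OF i1[THEN set_lebesgue_integral_eq_integral(1)]])
      fix s assume "s \<in> ?B"
      then have "0 \<le> G t s" by (intro G_nonneg t01) auto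
      then show "G t s * \<delta> s \<le> G t s * \<delta>p s" by (rule mult_left_mono[rotated]) (simp add: \<delta>p_def)
    qed
    also have "\<dots> = integral {0..1} (\<lambda>s. if s \<in> ?B then G t s * \<delta>p s else 0)"
      unfolding integral_restrict_Int by (rule arg_cong2[of _ _ _ _ integral]) auto
    also have "\<dots> = integral {0..1} (\<lambda>s. G t s * \<delta>0 s)"
      by (rule integral_cong) (simp add: \<delta>0_def)
    also have "\<dots> = green_op E t"
      by (rule green_op_eq_integral_kernel(2)[OF \<delta>0 t01, symmetric]) (simp add: E_def)
    also have "\<dots> \<le> green_op H t"
    proof -
      \<comment> \<open>At this stage \<open>H\<close> is not known to be the primitive of the
        superposition. Monotonicity of \<open>H - E\<close> replaces the comparison of
        densities.\<close>
      have "mono_on {0..1} (\<lambda>s. H s - E s)"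
      proof (rule mono_onI)
        fix x z :: real assume "x \<in> {0..1}" "z \<in> {0..1}" and xz: "x \<le> z"
        then have xz01: "0 \<le> x" "z \<le> 1" by auto
        have "integral {x..z} \<delta>0 \<le> H z - H x"
        proof (rule low[OF xz01(1) xz xz01(2)])
          show "\<delta>0 absolutely_integrable_on {x..z}"
            by (rule absolutely_integrable_on_subinterval[OF \<delta>0]) (use xz01 in auto)
          show "\<forall>\<^sub>F n in sequentially. AE s in lebesgue. s \<in> {x..z} \<longrightarrow> \<delta>0 s \<le> hm n s"
          proof (rule always_eventually, rule allI)
            fix n
            show "AE s in lebesgue. s \<in> {x..z} \<longrightarrow> \<delta>0 s \<le> hm n s"
              using hm_bounds[of n] hm_low[of n]
              by eventually_elim (use xz01 in \<open>auto simp: \<delta>0_def \<delta>p_def\<close>)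
          qed
        qed
        moreover have "E z - E x = integral {x..z} \<delta>0"
          unfolding E_def by (rule integral_increment[OF set_lebesgue_integral_eq_integral(1)[OF \<delta>0] xz01(1) xz xz01(2)])
        ultimately show "H x - E x \<le> H z - E z" by linarith
      qed
      then have "0 \<le> green_op (\<lambda>s. H s - E s) t"
        by (rule green_op_nonneg[OF _ continuous_on_diff[OF inc_cont[OF H] E_cont] t01])
      moreover have diff: "integral {0..x} (\<lambda>s. H s - E s) = integral {0..x} H - integral {0..x} E" if "x \<in> {0..1}" for x
        by (rule Henstock_Kurzweil_Integration.integral_diff;
            rule integrable_continuous_interval, rule continuous_on_subset[OF inc_cont[OF H]] continuous_on_subset[OF E_cont])
           (use that in auto)
      ultimately show ?thesis using diff[OF t01] diff[of 1] by (simp add: green_op_def right_diff_distrib)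
    qed
    finally show ?thesis .
  qed
  have nrm_ge: "\<delta>bar \<le> nrm H"
    unfolding \<delta>bar_def
  proof (rule cSUP_least)
    fix t assume t: "t \<in> ?B"
    show "(LINT s:?B|lebesgue. kker t s * \<delta> s) \<le> nrm H"
      using green_ge[OF t] green_nrm[OF H, of t] t by auto
  qed simp
  \<comment> \<open>Positivity is established for the limit only; approximations of norm zero are
    covered by the division convention in \<open>base\<close>.\<close>
  then have nrm0: "0 < nrm H" using \<delta>bar by linarith
  define lam where "lam = \<rho> / nrm H"
  have lam0: "0 < lam" using \<rho> nrm0 by (simp add: lam_def)
  have "lam \<le> \<rho> / \<delta>bar" unfolding lam_def using nrm_ge \<delta>bar nrm0 \<rho> by (intro divide_left_mono) auto
  then have lam_less: "lam < lbar" using lbar by linarith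

  \<comment> \<open>Convergence of the perturbed approximations to u\<close>
  define u where "u = base H"
  have u_adm: "adm u" unfolding u_def by (rule base_adm[OF H])
  have u_eq: "u t = y t + (if t \<le> 0 then 0 else lam * green_op H t)" for t
    by (simp add: u_def base_def lam_def)
  \<comment> \<open>The ratio \<open>q\<close> of \<open>green_op H' t\<close> to
    \<open>nrm H'\<close> has modulus at most 1, also when the norm vanishes. Changing the norm and
    changing the potential cost 2e each, scaled by \<open>lam\<close>; no lower bound on
    \<open>nrm H'\<close> enters.\<close>
  have base_close: "\<bar>base H' t - u t\<bar> \<le> 4 * lam * e"
    if H': "H' \<in> increments_below m" and e: "\<And>s. s \<in> {0..1} \<Longrightarrow> \<bar>H' s - H s\<bar> \<le> e" and t: "t \<in> {-r..1}" for H' e t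
  proof -
    have e0: "0 \<le> e" using e[of 0] by auto
    show ?thesis
    proof (cases "t \<le> 0")
      case True
      then show ?thesis using e0 lam0 by (simp add: u_def base_def)
    next
      case False
      then have t01: "t \<in> {0..1}" using t by auto
      let ?v = "green_op H' t" and ?w = "green_op H t"
      have vw: "\<bar>green_op H' x - green_op H x\<bar> \<le> 2 * e" if "x \<in> {0..1}" for x
        using that by (intro green_op_diff_le inc_cont H' H e)
      have nn: "\<bar>nrm H' - nrm H\<bar> \<le> 2 * e"
        unfolding nrm_def by (rule abs_supnorm_diff_le[OF _ green_cont[OF H'] green_cont[OF H] vw]) auto
      have v: "0 \<le> ?v" "?v \<le> nrm H'" using green0[OF H' t01] green_nrm[OF H' t01] by auto
      define q where "q = ?v / nrm H'"
      have q: "?v = q * nrm H'" "\<bar>q\<bar> \<le> 1"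
        using v by (auto simp: q_def divide_le_eq_1)
      have "(q * nrm H - ?w) = q * (nrm H - nrm H') + (?v - ?w)" using q(1) by (simp add: algebra_simps)
      also have "\<bar>\<dots>\<bar> \<le> 1 * (2 * e) + 2 * e"
      proof (rule order_trans[OF abs_triangle_ineq add_mono])
        show "\<bar>q * (nrm H - nrm H')\<bar> \<le> 1 * (2 * e)"
          unfolding abs_mult using q(2) nn by (intro mult_mono) (auto simp: abs_minus_commute)
      qed (rule vw[OF t01])
      finally have qw: "\<bar>q * nrm H - ?w\<bar> \<le> 4 * e" by simp
      have "base H' t - u t = lam * (q * nrm H - ?w)"
        using False nrm0 by (simp add: u_eq base_def lam_def q_def field_simps)
      also have "\<bar>\<dots>\<bar> = lam * \<bar>q * nrm H - ?w\<bar>" using lam0 by (simp add: abs_mult)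
      also have "\<dots> \<le> lam * (4 * e)" using qw lam0 by (intro mult_left_mono) auto
      finally show ?thesis by simp
    qed
  qed
  have U_near: "\<forall>\<^sub>F n in sequentially. \<forall>i. \<forall>t\<in>{-r..1}.
      \<bar>U (k n) (Hp n i) t - u t\<bar> \<le> \<epsilon> \<and> \<bar>U (k n) (Hm n i) t - u t\<bar> \<le> \<epsilon>" if \<epsilon>: "0 < \<epsilon>" for \<epsilon>
  proof -
    define e where "e = \<epsilon> / (8 * lam)"
    have e: "0 < e" "4 * lam * e = \<epsilon> / 2" using \<epsilon> lam0 by (auto simp: e_def)
    have "(\<lambda>n. R / real (Suc n)) \<longlonglongrightarrow> 0" by (rule LIMSEQ_Suc[OF lim_const_over_n])
    then have "\<forall>\<^sub>F n in sequentially. R / real (Suc n) < \<epsilon> / 2"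
      by (rule order_tendstoD(2)) (use \<epsilon> in simp)
    then show ?thesis using close[OF e(1)]
    proof eventually_elim
      case (elim n)
      have "R / real (Suc (k n)) \<le> R / real (Suc n)"
        using R0 seq_suble[OF k, of n] by (intro divide_left_mono) auto
      then have Rk: "R / real (Suc (k n)) \<le> \<epsilon> / 2" using elim(1) by linarith
      show ?case
      proof (intro allI ballI)
        fix i t assume t: "t \<in> {-r..1}"
        have "\<bar>base (Hp n i) t - u t\<bar> \<le> \<epsilon> / 2" "\<bar>base (Hm n i) t - u t\<bar> \<le> \<epsilon> / 2"
          using base_close[OF Hp _ t, of n i e] base_close[OF Hm _ t, of n i e] elim(2) e(2) by auto
        then show "\<bar>U (k n) (Hp n i) t - u t\<bar> \<le> \<epsilon> \<and> \<bar>U (k n) (Hm n i) t - u t\<bar> \<le> \<epsilon>"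
          using U_base[OF Hp t, of "k n" n i] U_base[OF Hm t, of "k n" n i] Rk by linarith
      qed
    qed
  qed

  \<comment> \<open>The limit u meets the curves in a null set\<close>
  have U_R: "0 \<le> U n H' t" if "H' \<in> increments_below m" "t \<in> {-r..1}" for n H' t
    using U_adm[OF that(1), of n] that(2) by (simp add: adm_def)
  have null: "negligible {t\<in>{a j..b j}. u t = \<gamma> j t}" for j
  proof (rule negligible_curve_contact[where H = H and M = M0 and hp = hp and hm = hm and c = "\<omega> 0"])
    show "admissible f lam (a j) (b j) (\<gamma> j)" using H4adm[OF lam0] lam_less by simp
    show "u t = (1 - t) * \<omega> 0 + lam * green_op H t" if "t \<in> {0..1}" for t
      using that by (cases "t = 0") (auto simp: u_eq y_def yfun_def green_op_def)
    show "AE s in lebesgue. s \<in> {0..1} \<longrightarrow> 0 \<le> hm n s" for n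
      using hm_bounds[of n] by eventually_elim simp
    show "AE s in lebesgue. s \<in> {0..1} \<longrightarrow> hp n s \<le> M0 s" for n
      using hp_bounds[of n] by eventually_elim simp
    show "\<forall>\<^sub>F n in sequentially. \<forall>s\<in>{0..1}.
        (\<exists>x z. hm n s = f s x z \<and> 0 \<le> x \<and> 0 \<le> z \<and> \<bar>x - u s\<bar> \<le> \<epsilon>) \<and>
        (\<exists>x z. hp n s = f s x z \<and> 0 \<le> x \<and> 0 \<le> z \<and> \<bar>x - u s\<bar> \<le> \<epsilon>)" if "0 < \<epsilon>" for \<epsilon>
      using U_near[OF that]
    proof eventually_elim
      case (elim n)
      show ?case
      proof
        fix s :: real assume s: "s \<in> {0..1}"
        obtain i i' where i: "hm n s = nemytskii (U (k n) (Hm n i)) s" "hp n s = nemytskii (U (k n) (Hp n i')) s"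
          using hm hp by blast
        have nr: "\<bar>U (k n) (Hm n i) s - u s\<bar> \<le> \<epsilon>" "\<bar>U (k n) (Hp n i') s - u s\<bar> \<le> \<epsilon>"
          using elim in_r[OF s] by blast+
        show "(\<exists>x z. hm n s = f s x z \<and> 0 \<le> x \<and> 0 \<le> z \<and> \<bar>x - u s\<bar> \<le> \<epsilon>) \<and>
          (\<exists>x z. hp n s = f s x z \<and> 0 \<le> x \<and> 0 \<le> z \<and> \<bar>x - u s\<bar> \<le> \<epsilon>)"
          unfolding i nemytskii_def
          using nr U_R[OF Hm in_r[OF s]] U_R[OF Hm \<sigma>in[OF s]] U_R[OF Hp in_r[OF s]] U_R[OF Hp \<sigma>in[OF s]]
          by blast
      qed
    qed
  qed (fact lam0 inc_cont[OF H] low up M0)+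
  have u_av: "AE s in lebesgue. \<forall>j. s \<in> {a j..b j} \<longrightarrow> u s \<noteq> \<gamma> j s"
    unfolding AE_all_countable
  proof
    fix j
    have "{t\<in>{a j..b j}. u t = \<gamma> j t} = {t. \<not> (t \<in> {a j..b j} \<longrightarrow> u t \<noteq> \<gamma> j t)}" by auto
    then show "AE s in lebesgue. s \<in> {a j..b j} \<longrightarrow> u s \<noteq> \<gamma> j s"
      using null[of j] by (simp only: negligible_iff_AE)
  qed

  \<comment> \<open>Passage to the limit in the superposition operator\<close>
  have lim: "(\<lambda>n. integral {0..t} (hq n)) \<longlonglongrightarrow> integral {0..t} (nemytskii u)"
    if Hq: "\<And>n i. Hq n i \<in> increments_below m"
      and hq: "\<And>n s. \<exists>i::nat. hq n s = nemytskii (U (k n) (Hq n i)) s"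
      and near: "\<And>\<epsilon>. 0 < \<epsilon> \<Longrightarrow> \<forall>\<^sub>F n in sequentially. \<forall>i. \<forall>t\<in>{-r..1}. \<bar>U (k n) (Hq n i) t - u t\<bar> \<le> \<epsilon>"
      and bounds: "\<And>n. AE s in lebesgue. s \<in> {0..1} \<longrightarrow> 0 \<le> hq n s \<and> hq n s \<le> M0 s"
      and int: "\<And>n. hq n absolutely_integrable_on {0..1}" and t: "t \<in> {0..1}" for Hq hq t
  proof -
    have av: "AE s in lebesgue. \<forall>n i j. s \<in> {a j..b j} \<longrightarrow> U (k n) (Hq n i) s \<noteq> \<gamma> j s"
      unfolding AE_all_countable[where 'i = nat] using U_av[OF Hq] by (simp add: AE_all_countable)
    have conv: "AE s in lebesgue. s \<in> {0..1} \<longrightarrow> (\<lambda>n. hq n s) \<longlonglongrightarrow> nemytskii u s"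
      using H4cont u_av av
    proof eventually_elim
      case (elim s)
      show ?case
      proof
        assume s: "s \<in> {0..1}"
        let ?X = "({0..} - {\<gamma> n s | n. s \<in> {a n..b n}}) \<times> {0..}"
        \<comment> \<open>The cell index is chosen separately for each n at this fixed s;
          convergence survives because closeness is uniform in i.\<close>
        have "\<forall>n. \<exists>i. hq n s = nemytskii (U (k n) (Hq n i)) s" using hq by blast
        from choice[OF this] obtain i where i: "\<And>n. hq n s = nemytskii (U (k n) (Hq n (i n))) s" by blast
        have tends: "(\<lambda>n. U (k n) (Hq n (i n)) x) \<longlonglongrightarrow> u x" if x: "x \<in> {-r..1}" for x
        proof (rule tendstoI)
          fix e :: real assume e: "0 < e"
          then have "0 < e / 2" by simp
          from near[OF this] show "\<forall>\<^sub>F n in sequentially. dist (U (k n) (Hq n (i n)) x) (u x) < e"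
          proof eventually_elim
            case (elim n)
            then have "\<bar>U (k n) (Hq n (i n)) x - u x\<bar> \<le> e / 2" using x by blast
            then show ?case using e by (simp add: dist_real_def)
          qed
        qed
        have c1: "continuous_on ?X (\<lambda>(x, z). f s x z)" using elim(1) s by blast
        have c2: "(\<lambda>n. (U (k n) (Hq n (i n)) s, U (k n) (Hq n (i n)) (\<sigma> s))) \<longlonglongrightarrow> (u s, u (\<sigma> s))"
          by (intro tendsto_Pair tends in_r[OF s] \<sigma>in[OF s])
        have c3: "(u s, u (\<sigma> s)) \<in> ?X"
          using u_adm in_r[OF s] \<sigma>in[OF s] elim(2) by (auto simp: adm_def)
        \<comment> \<open>Continuity holds only relative to \<open>?X\<close>, so the approximating
          points must also lie in \<open>?X\<close>. This is what the perturbation \<open>U\<close>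
          was made for.\<close>
        have c4: "\<forall>\<^sub>F n in sequentially. (U (k n) (Hq n (i n)) s, U (k n) (Hq n (i n)) (\<sigma> s)) \<in> ?X"
          using U_R[OF Hq in_r[OF s]] U_R[OF Hq \<sigma>in[OF s]] elim(3) by (intro always_eventually) auto
        from continuous_on_tendsto_compose[OF c1 c2 c3 c4]
        show "(\<lambda>n. hq n s) \<longlonglongrightarrow> nemytskii u s" by (simp add: i nemytskii_def)
      qed
    qed
    have sub: "g absolutely_integrable_on {0..t}" if "g absolutely_integrable_on {0..1}" for g :: "real \<Rightarrow> real"
      by (rule absolutely_integrable_on_subinterval[OF that]) (use t in auto)
    have "(\<lambda>n. integral\<^sup>L lebesgue (\<lambda>s. indicator {0..t} s *\<^sub>R hq n s))
        \<longlonglongrightarrow> integral\<^sup>L lebesgue (\<lambda>s. indicator {0..t} s *\<^sub>R nemytskii u s)"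
    proof (rule integral_dominated_convergence[where w = "\<lambda>s. indicator {0..t} s *\<^sub>R M0 s"])
      show "integrable lebesgue (\<lambda>s. indicator {0..t} s *\<^sub>R M0 s)"
        using sub[OF M0] by (simp only: set_integrable_def)
      show "(\<lambda>s. indicator {0..t} s *\<^sub>R nemytskii u s) \<in> borel_measurable lebesgue"
        using sub[OF nem_int[OF u_adm]] unfolding set_integrable_def by (rule borel_measurable_integrable)
      show "(\<lambda>s. indicator {0..t} s *\<^sub>R hq n s) \<in> borel_measurable lebesgue" for n
        using sub[OF int[of n]] unfolding set_integrable_def by (rule borel_measurable_integrable)
      show "AE s in lebesgue. (\<lambda>n. indicator {0..t} s *\<^sub>R hq n s) \<longlonglongrightarrow> indicator {0..t} s *\<^sub>R nemytskii u s"
        using conv by eventually_elim (use t in \<open>auto simp: indicator_def\<close>)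
      show "AE s in lebesgue. norm (indicator {0..t} s *\<^sub>R hq n s) \<le> indicator {0..t} s *\<^sub>R M0 s" for n
        using bounds[of n] by eventually_elim (use t in \<open>auto simp: indicator_def\<close>)
    qed
    then show ?thesis
      using set_lebesgue_integral_eq_integral(2)[OF sub[OF int]]
        set_lebesgue_integral_eq_integral(2)[OF sub[OF nem_int[OF u_adm]]]
      by (simp add: set_lebesgue_integral_def)
  qed
  \<comment> \<open>The increments of \<open>H\<close> lie between the integrals of
    \<open>hm\<close> and \<open>hp\<close> up to vanishing errors. Both integrals have the same
    limit, which squeezes \<open>H\<close>.\<close>
  have H_eq: "H t = integral {0..t} (nemytskii u)" if t: "t \<in> {0..1}" for t
  proof (rule antisym)
    have H0: "H 0 = 0" by (rule increments_belowD(1)[OF H])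
    have limp: "(\<lambda>n. integral {0..t} (hp n)) \<longlonglongrightarrow> integral {0..t} (nemytskii u)"
    proof (rule lim[OF Hp hp _ hp_bounds hp_int t])
      show "\<forall>\<^sub>F n in sequentially. \<forall>i. \<forall>t\<in>{-r..1}. \<bar>U (k n) (Hp n i) t - u t\<bar> \<le> \<epsilon>" if "0 < \<epsilon>" for \<epsilon>
        using U_near[OF that] by eventually_elim blast
    qed
    have limm: "(\<lambda>n. integral {0..t} (hm n)) \<longlonglongrightarrow> integral {0..t} (nemytskii u)"
    proof (rule lim[OF Hm hm _ hm_bounds hm_int t])
      show "\<forall>\<^sub>F n in sequentially. \<forall>i. \<forall>t\<in>{-r..1}. \<bar>U (k n) (Hm n i) t - u t\<bar> \<le> \<epsilon>" if "0 < \<epsilon>" for \<epsilon>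
        using U_near[OF that] by eventually_elim blast
    qed
    show "H t \<le> integral {0..t} (nemytskii u)"
    proof (rule field_le_epsilon)
      fix e :: real assume e: "0 < e"
      show "H t \<le> integral {0..t} (nemytskii u) + e"
      proof (rule tendsto_lowerbound[OF tendsto_add[OF limp tendsto_const]])
        show "\<forall>\<^sub>F n in sequentially. H t \<le> integral {0..t} (hp n) + e"
          using incs[OF e] by eventually_elim (use t H0 in force)
      qed simp
    qed
    show "integral {0..t} (nemytskii u) \<le> H t"
    proof (rule field_le_epsilon)
      fix e :: real assume e: "0 < e"
      show "integral {0..t} (nemytskii u) \<le> H t + e"
      proof (rule tendsto_upperbound[OF limm])
        show "\<forall>\<^sub>F n in sequentially. integral {0..t} (hm n) \<le> H t + e"
          using incs[OF e] by eventually_elim (use t H0 in force)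
      qed simp
    qed
  qed

  \<comment> \<open>The integral equation and membership in the cone\<close>
  note green_int = green_op_eq_integral_kernel[OF nem_int[OF u_adm] _ H_eq]
  have kernel: "(LINT s:{0..1}|lebesgue. kker t s * nemytskii u s) = green_op H t" if t: "t \<in> {0..1}" for t
    using set_lebesgue_integral_eq_integral(2)[OF green_int(1)[OF t]] green_int(2)[OF t] t
    by (simp add: kker_def)
  \<comment> \<open>With \<open>H\<close> now a genuine primitive, the kernel estimate
    \<open>G_ge_quarter\<close> can be integrated against the nonnegative density.\<close>
  have quarter: "green_op H t' / 4 \<le> green_op H t" if t: "t \<in> ?B" and t': "t' \<in> {0..1}" for t t'
  proof -
    have t01: "t \<in> {0..1}" using t by auto
    have "(\<lambda>s. G t' s * nemytskii u s / 4) absolutely_integrable_on {0..1}"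
      by (intro set_integrable_divide green_int(1)[OF t'])
    then have "integral {0..1} (\<lambda>s. G t' s * nemytskii u s / 4) \<le> integral {0..1} (\<lambda>s. G t s * nemytskii u s)"
    proof (rule integral_mono_AE_interval[OF _ green_int(1)[OF t01]])
      show "AE s in lebesgue. s \<in> {0..1} \<longrightarrow> G t' s * nemytskii u s / 4 \<le> G t s * nemytskii u s"
        using nem_bounds[OF u_adm]
      proof eventually_elim
        case (elim s)
        show ?case
        proof
          assume s: "s \<in> {0..1}"
          have "G t' s / 4 * nemytskii u s \<le> G t s * nemytskii u s"
            using G_ge_quarter[OF t t' s] elim s by (intro mult_right_mono) auto
          then show "G t' s * nemytskii u s / 4 \<le> G t s * nemytskii u s" by simp
        qed
      qed
    qed
    then show ?thesis using green_int(2)[OF t01] green_int(2)[OF t'] by simp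
  qed
  define v where "v t = (if t \<le> 0 then 0 else lam * green_op H t)" for t
  have v01: "v t = lam * green_op H t" if "t \<in> {0..1}" for t
    using that by (auto simp: v_def green_op_def)
  have v_norm: "supnorm 0 1 v = \<rho>"
  proof -
    have "supnorm 0 1 v \<le> \<rho>"
    proof (rule supnorm_le)
      fix t :: real assume t: "t \<in> {0..1}"
      have "lam * green_op H t \<le> lam * nrm H" using green_nrm[OF H t] lam0 by simp
      moreover have "lam * nrm H = \<rho>" using nrm0 by (simp add: lam_def)
      moreover have "0 \<le> lam * green_op H t" using green0[OF H t] lam0 by simp
      ultimately show "\<bar>v t\<bar> \<le> \<rho>" using v01[OF t] by simp
    qed simp
    moreover have "nrm H \<le> supnorm 0 1 v / lam"
      unfolding nrm_def
    proof (rule supnorm_le)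
      fix t :: real assume t: "t \<in> {0..1}"
      have "continuous_on {0..1} (\<lambda>t. lam * green_op H t)" by (intro continuous_intros green_cont[OF H])
      then have "continuous_on {0..1} v" by (rule continuous_on_eq) (simp add: v01)
      from abs_le_supnorm[OF this t] show "\<bar>green_op H t\<bar> \<le> supnorm 0 1 v / lam"
        using v01[OF t] lam0 by (simp add: abs_mult le_divide_eq mult.commute)
    qed simp
    then have "\<rho> \<le> supnorm 0 1 v" using lam0 nrm0 \<rho> by (simp add: lam_def field_simps)
    ultimately show ?thesis by simp
  qed
  have v_cone: "v \<in> coneK r"
    unfolding coneK_def mem_Collect_eq v_norm
  proof (intro conjI ballI)
    have "continuous_on {-r..1} (\<lambda>t. u t - y t)"
      using u_adm ycont by (intro continuous_on_diff) (auto simp: adm_def)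
    then show "continuous_on {-r..1} v" by (rule continuous_on_eq) (simp add: u_eq v_def)
    show "0 \<le> v t" if "t \<in> {-r..1}" for t
      using that green0[OF H, of t] lam0 by (auto simp: v_def)
    show "v t = 0" if "t \<in> {-r..0}" for t using that by (simp add: v_def)
    fix t assume t: "t \<in> ?B"
    have t01: "t \<in> {0..1}" using t by auto
    have "nrm H \<le> 4 * green_op H t"
      unfolding nrm_def
    proof (rule supnorm_le)
      fix t' :: real assume t': "t' \<in> {0..1}"
      show "\<bar>green_op H t'\<bar> \<le> 4 * green_op H t" using quarter[OF t t'] green0[OF H t'] by simp
    qed simp
    then have "lam * nrm H \<le> lam * (4 * green_op H t)" using lam0 by simp
    then show "\<rho> / 4 \<le> v t" using v01[OF t01] nrm0 by (simp add: lam_def)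
  qed
  show ?thesis
  proof (intro exI conjI ballI)
    show "0 < lam" "lam < lbar" by (fact lam0, fact lam_less)
    show "u \<in> bdKy r (yfun \<omega>) \<rho>"
      unfolding bdKy_def using v_cone v_norm u_eq by (auto simp: v_def y_def)
    show "set_integrable lebesgue {0..1} (\<lambda>s. f s (u s) (u (\<sigma> s)))"
      using nem_int[OF u_adm] by (simp add: nemytskii_def[abs_def])
    fix t assume t: "t \<in> {-r..1}"
    show "u t = yfun \<omega> t + lam * (LINT s:{0..1}|lebesgue. kker t s * f s (u s) (u (\<sigma> s)))"
    \<comment> \<open>The point 0 falls into the second case: \<open>kker\<close> uses the Green
      function there, whereas \<open>v\<close> already uses its zero branch. The two agree because
      \<open>green_op H 0 = 0\<close>.\<close>
    proof (cases "t < 0")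
      case True
      then show ?thesis by (simp add: u_eq y_def kker_def)
    next
      case False
      then have t01: "t \<in> {0..1}" using t by auto
      have "u t = y t + v t" by (simp add: u_eq v_def)
      then show ?thesis using kernel[OF t01] v01[OF t01] by (simp add: y_def nemytskii_def)
    qed
  qed
qed

end
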